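(* The following problem is undecidable: given a ruleset $\mathcal{R}$ and two rule instances $\hat\rho_1,\hat\rho_2\in\mathrm{instances}(\mathcal{R})$, decide whether the sequence $\hat\rho_1\hat\rho_2$ is a trail.
   Context: **Rules.** Fix countably infinite, mutually disjoint sets $\mathbf{P}$ (predicates, each with an arity $\geq 0$), $\mathbf{V}$ (variables), $\mathbf{C}$ (constants), $\mathbf{N}$ (nulls). An atom is $p(\vec t)$ with $p\in\mathbf{P}$ and $\vec t$ a list of $\mathrm{ar}(p)$ elements of $\mathbf{V}\cup\mathbf{C}\cup\mathbf{N}$; a fact is a variable-free atom; a database is a set of facts. A rule $\rho$ is a null-free expression $\mathrm{body}^+(\rho)\wedge\mathrm{body}^-(\rho)\to\exists\vec z.\,\mathrm{head}(\rho)$, where $\mathrm{body}^+(\rho)$ and $\mathrm{head}(\rho)$ are conjunctions of atoms and $\mathrm{body}^-(\rho)$ is a conjunction of negated atoms (all also treated as sets of atoms). The variables in $\mathrm{var}_\exists(\rho)=\vec z$ are existential, all others, $\mathrm{var}_\forall(\rho)$, are universal; every universal variable in $\mathrm{head}(\rho)$ or $\mathrm{body}^-(\rho)$ occurs in $\mathrm{body}^+(\rho)$. A ruleset is a finite set of rules. **Matches.** A match of $\rho$ over a database $\mathcal{I}$ is a pair $\langle\rho,\mu_\forall\rangle$ with $\mu_\forall$ a substitution defined on $\mathrm{var}_\forall(\rho)$ such that $\mathrm{body}^+(\rho)\mu_\forall\subseteq\mathcal{I}$ and $\mathrm{body}^-(\rho)\mu_\forall\cap\mathcal{I}=\varnothing$.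 It is satisfied in $\mathcal{I}$ if there is $\mu_\exists$ defined on $\mathrm{var}_\exists(\rho)$ with $\mathrm{head}(\rho)\mu_\forall\mu_\exists\subseteq\mathcal{I}$. We say $\mathcal{I}_b$ is obtained from $\mathcal{I}_a$ by applying $\rho$ for $\mu=\mu_\forall\mu_\exists$ if $\langle\rho,\mu_\forall\rangle$ is an unsatisfied match over $\mathcal{I}_a$, $\mu_\exists:\mathrm{var}_\exists(\rho)\to\mathbf{N}$ is injective with values fresh nulls (not occurring in $\mathcal{I}_a$), and $\mathcal{I}_b=\mathcal{I}_a\cup\mathrm{head}(\rho)\mu$. **Chase.** A chase $C$ for a null-free database $\mathcal{I}$ and ruleset $\mathcal{R}$ is a (possibly infinite) sequence of databases $\mathrm{db}_C(0),\mathrm{db}_C(1),\dots$ with $\mathrm{db}_C(0)=\mathcal{I}$ such that (1) for each step $i>0$, $\mathrm{db}_C(i)$ is obtained from $\mathrm{db}_C(i-1)$ by applying some $\mathrm{rule}_C(i)\in\mathcal{R}$ for some $\mu$, the applied match being denoted $\mathrm{match}_C(i)$; (2) (fairness) if $\langle\rho,\mu\rangle$, $\rho\in\mathcal{R}$, is a match over $\mathrm{db}_C(i)$ for some $i\ge 0$, then there is $j\geq i$ such that $\langle\rho,\mu\rangle$ is satisfied in $\mathrm{db}_C(j)$. Its result is $\mathrm{chase}_C(\mathcal{I},\mathcal{R})=\bigcup_i\mathrm{db}_C(i)$. $C$ is generating if every $\mathrm{match}_C(i)$ is a match over $\mathrm{chase}_C(\mathcal{I},\mathcal{R})$. **Trails.**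 $\mathrm{instances}(\mathcal{R})=\{\rho\theta\mid\rho\in\mathcal{R},\ \theta:\mathrm{var}(\rho)\to\mathbf{V}\setminus\mathrm{var}(\mathcal{R})\}$ (rule instances). Fix an arbitrary bijection $\omega:(\mathbf{V}\setminus\mathrm{var}(\mathcal{R}))\to\mathbf{C}\cup\mathbf{N}$; together with $\omega$, an instance $\hat\rho=\rho\theta$ represents the match $\langle\hat\rho,\omega\rangle$ of $\rho$, i.e. $\langle\rho,\theta\omega\rangle$ (including the values of existential variables). A finite sequence of rule instances is $\exists$-disjoint if its members have pairwise disjoint sets of existential variables. An $\exists$-disjoint sequence $\hat\rho_1,\dots,\hat\rho_n$ is a trail if there is a generating chase $C$ (for $\mathcal{R}$ and some null-free database) and a strictly increasing function $f$ from $\{1,\dots,n\}$ to the steps of $C$ such that for all $i$: $\langle\hat\rho_i,\omega\rangle=\mathrm{match}_C(f(i))$, and if $i>1$ then $\mathrm{body}^+(\hat\rho_i)\omega\cap\mathrm{head}(\hat\rho_{i-1})\omega\neq\varnothing$. *)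

theory Defs
  imports "HOL-Library.Nat_Bijection" "HOL-Library.Extended_Nat"
begin

section \<open>Existential rules with negation\<close>

text \<open>
  The symbol sets are concrete disjoint copies of the naturals, so that inputs of decision problems
  are finite objects. There are countably infinitely many predicates of each arity.
\<close>

datatype trm = Var nat | Const nat | Null nat

datatype predsym = Pred nat (arity: nat)

datatype atom = Atom (pred_of: predsym) (args: "trm list")

definition wf_atom :: "atom \<Rightarrow> bool" where
  "wf_atom a \<longleftrightarrow> length (args a) = arity (pred_of a)"

definition vars_atom :: "atom \<Rightarrow> nat set" where
  "vars_atom a = {x. Var x \<in> set (args a)}"

definition nulls_atom :: "atom \<Rightarrow> nat set" where
  "nulls_atom a = {n. Null n \<in> set (args a)}"

definition vars_atoms :: "atom set \<Rightarrow> nat set" where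
  "vars_atoms A = (\<Union>a\<in>A. vars_atom a)"

definition nulls_atoms :: "atom set \<Rightarrow> nat set" where
  "nulls_atoms A = (\<Union>a\<in>A. nulls_atom a)"

definition is_fact :: "atom \<Rightarrow> bool" where
  "is_fact a \<longleftrightarrow> wf_atom a \<and> vars_atom a = {}"

type_synonym db = "atom set"

definition is_database :: "db \<Rightarrow> bool" where
  "is_database I \<longleftrightarrow> (\<forall>a\<in>I. is_fact a)"

text \<open>
  \<open>Rule B N zs H\<close> is \<open>B \<and> \<not>N \<longrightarrow> \<exists>zs. H\<close>, where \<open>\<not>N\<close> is the conjunction of the negations of the atoms
  in \<open>N\<close>. The quantifier prefix is explicit because it cannot be recovered from the atoms of a rule
  instance, where existential and universal variables may have been identified.
\<close>

datatype rule =
  Rule (pbody_list: "atom list") (nbody_list: "atom list") (ex_list: "nat list")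
    (head_list: "atom list")

definition pbody :: "rule \<Rightarrow> atom set" where "pbody \<rho> = set (pbody_list \<rho>)"
definition nbody :: "rule \<Rightarrow> atom set" where "nbody \<rho> = set (nbody_list \<rho>)"
definition head :: "rule \<Rightarrow> atom set" where "head \<rho> = set (head_list \<rho>)"
definition evars :: "rule \<Rightarrow> nat set" where "evars \<rho> = set (ex_list \<rho>)"

definition vars_rule :: "rule \<Rightarrow> nat set" where
  "vars_rule \<rho> = vars_atoms (pbody \<rho> \<union> nbody \<rho> \<union> head \<rho>) \<union> evars \<rho>"

definition uvars :: "rule \<Rightarrow> nat set" where
  "uvars \<rho> = vars_rule \<rho> - evars \<rho>"

definition wf_rule :: "rule \<Rightarrow> bool" where
  "wf_rule \<rho> \<longleftrightarrow>
     (\<forall>a \<in> pbody \<rho> \<union> nbody \<rho> \<union> head \<rho>. wf_atom a \<and> nulls_atom a = {}) \<and>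
     evars \<rho> \<inter> vars_atoms (pbody \<rho> \<union> nbody \<rho>) = {} \<and>
     uvars \<rho> \<inter> vars_atoms (nbody \<rho> \<union> head \<rho>) \<subseteq> vars_atoms (pbody \<rho>)"

definition is_ruleset :: "rule set \<Rightarrow> bool" where
  "is_ruleset R \<longleftrightarrow> finite R \<and> (\<forall>\<rho>\<in>R. wf_rule \<rho>)"

definition vars_ruleset :: "rule set \<Rightarrow> nat set" where
  "vars_ruleset R = (\<Union>\<rho>\<in>R. vars_rule \<rho>)"


section \<open>Matches and rule applications\<close>

type_synonym subst = "nat \<rightharpoonup> trm"

fun subst_trm :: "subst \<Rightarrow> trm \<Rightarrow> trm" where
  "subst_trm \<mu> (Var x) = (case \<mu> x of Some t \<Rightarrow> t | None \<Rightarrow> Var x)"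
| "subst_trm \<mu> (Const c) = Const c"
| "subst_trm \<mu> (Null n) = Null n"

definition subst_atom :: "subst \<Rightarrow> atom \<Rightarrow> atom" where
  "subst_atom \<mu> a = Atom (pred_of a) (map (subst_trm \<mu>) (args a))"

definition is_match :: "db \<Rightarrow> rule \<Rightarrow> subst \<Rightarrow> bool" where
  "is_match I \<rho> \<mu> \<longleftrightarrow>
     dom \<mu> = uvars \<rho> \<and>
     subst_atom \<mu> ` pbody \<rho> \<subseteq> I \<and>
     subst_atom \<mu> ` nbody \<rho> \<inter> I = {}"

definition satisfied :: "db \<Rightarrow> rule \<Rightarrow> subst \<Rightarrow> bool" where
  "satisfied I \<rho> \<mu> \<longleftrightarrow>
     (\<exists>\<mu>'. dom \<mu>' = evars \<rho> \<and> subst_atom (\<mu> ++ \<mu>') ` head \<rho> \<subseteq> I)"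

text \<open>
  Below, \<open>\<mu>\<close> is the combined substitution, whose restrictions to the universal and to the existential
  variables are the match and the choice of fresh nulls.
\<close>

definition applied :: "db \<Rightarrow> rule \<Rightarrow> subst \<Rightarrow> db \<Rightarrow> bool" where
  "applied I \<rho> \<mu> J \<longleftrightarrow>
     dom \<mu> = vars_rule \<rho> \<and>
     is_match I \<rho> (\<mu> |` uvars \<rho>) \<and>
     \<not> satisfied I \<rho> (\<mu> |` uvars \<rho>) \<and>
     inj_on \<mu> (evars \<rho>) \<and>
     (\<forall>z\<in>evars \<rho>. \<exists>n. \<mu> z = Some (Null n) \<and> n \<notin> nulls_atoms I) \<and>
     J = I \<union> subst_atom \<mu> ` head \<rho>"


section \<open>The restricted chase\<close>

text \<open>
  A chase has the databases with indices \<open>i \<le> len\<close>; rule and substitution are relevant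
  only for the steps \<open>0 < i \<le> len\<close>. The substitution \<open>sub_at\<close> includes the values of existential
  variables.
\<close>

datatype chase =
  Chase (len: enat) (db_at: "nat \<Rightarrow> db") (rule_at: "nat \<Rightarrow> rule") (sub_at: "nat \<Rightarrow> subst")

definition steps :: "chase \<Rightarrow> nat set" where
  "steps C = {i. 0 < i \<and> enat i \<le> len C}"

definition is_chase :: "db \<Rightarrow> rule set \<Rightarrow> chase \<Rightarrow> bool" where
  "is_chase I R C \<longleftrightarrow>
     db_at C 0 = I \<and>
     (\<forall>i\<in>steps C. rule_at C i \<in> R \<and>
        applied (db_at C (i - 1)) (rule_at C i) (sub_at C i) (db_at C i)) \<and>
     (\<forall>i \<rho> \<mu>. enat i \<le> len C \<and> \<rho> \<in> R \<and> is_match (db_at C i) \<rho> \<mu> \<longrightarrow>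
        (\<exists>j\<ge>i. enat j \<le> len C \<and> satisfied (db_at C j) \<rho> \<mu>))"

definition chase_result :: "chase \<Rightarrow> db" where
  "chase_result C = (\<Union>i\<in>{i. enat i \<le> len C}. db_at C i)"

definition generating :: "chase \<Rightarrow> bool" where
  "generating C \<longleftrightarrow>
     (\<forall>i\<in>steps C. is_match (chase_result C) (rule_at C i) (sub_at C i |` uvars (rule_at C i)))"


section \<open>Rule instances and trails\<close>

definition rename_atom :: "(nat \<Rightarrow> nat) \<Rightarrow> atom \<Rightarrow> atom" where
  "rename_atom \<theta> = subst_atom (\<lambda>x. Some (Var (\<theta> x)))"

definition rename_rule :: "(nat \<Rightarrow> nat) \<Rightarrow> rule \<Rightarrow> rule" where
  "rename_rule \<theta> \<rho> =
     Rule (map (rename_atom \<theta>) (pbody_list \<rho>)) (map (rename_atom \<theta>) (nbody_list \<rho>))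
       (map \<theta> (ex_list \<rho>)) (map (rename_atom \<theta>) (head_list \<rho>))"

definition instances :: "rule set \<Rightarrow> rule set" where
  "instances R =
     {rename_rule \<theta> \<rho> | \<rho> \<theta>. \<rho> \<in> R \<and> \<theta> ` vars_rule \<rho> \<subseteq> UNIV - vars_ruleset R}"

definition is_labelling :: "rule set \<Rightarrow> (nat \<Rightarrow> trm) \<Rightarrow> bool" where
  "is_labelling R \<omega> \<longleftrightarrow> bij_betw \<omega> (UNIV - vars_ruleset R) (range Const \<union> range Null)"

definition ground_atoms :: "(nat \<Rightarrow> trm) \<Rightarrow> atom set \<Rightarrow> atom set" where
  "ground_atoms \<omega> A = subst_atom (\<lambda>x. Some (\<omega> x)) ` A"

text \<open>
  \<open>represents R \<omega> \<rho>' \<rho> \<mu>\<close>: the instance \<open>\<rho>'\<close> has the form \<open>\<rho>\<theta>\<close> for a rule \<open>\<rho>\<close> of \<open>R\<close>, and \<open>\<mu>\<close> is the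
  composition \<open>\<theta>\<omega>\<close> on all variables of \<open>\<rho>\<close>, existential ones included.
\<close>

definition represents :: "rule set \<Rightarrow> (nat \<Rightarrow> trm) \<Rightarrow> rule \<Rightarrow> rule \<Rightarrow> subst \<Rightarrow> bool" where
  "represents R \<omega> \<rho>' \<rho> \<mu> \<longleftrightarrow>
     \<rho> \<in> R \<and>
     (\<exists>\<theta>. \<theta> ` vars_rule \<rho> \<subseteq> UNIV - vars_ruleset R \<and> \<rho>' = rename_rule \<theta> \<rho> \<and>
        \<mu> = (\<lambda>x. Some (\<omega> (\<theta> x))) |` vars_rule \<rho>)"

definition ex_disjoint :: "rule list \<Rightarrow> bool" where
  "ex_disjoint rs \<longleftrightarrow>
     (\<forall>j<length rs. \<forall>i<j. evars (rs ! i) \<inter> evars (rs ! j) = {})"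

definition is_trail :: "rule set \<Rightarrow> (nat \<Rightarrow> trm) \<Rightarrow> rule list \<Rightarrow> bool" where
  "is_trail R \<omega> rs \<longleftrightarrow>
     set rs \<subseteq> instances R \<and> ex_disjoint rs \<and>
     (\<exists>I C f. is_database I \<and> nulls_atoms I = {} \<and> is_chase I R C \<and> generating C \<and>
        f ` {..<length rs} \<subseteq> steps C \<and> strict_mono_on {..<length rs} f \<and>
        (\<forall>i<length rs. represents R \<omega> (rs ! i) (rule_at C (f i)) (sub_at C (f i))) \<and>
        (\<forall>i<length rs. 0 < i \<longrightarrow>
           ground_atoms \<omega> (pbody (rs ! i)) \<inter> ground_atoms \<omega> (head (rs ! (i - 1))) \<noteq> {}))"


section \<open>Partial recursive functions and decidability\<close>

text \<open>
  Kleene's partial recursive functions, presented by syntactic descriptions together with their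
  evaluation relation; \<open>rec_eval f xs y\<close> means that \<open>f\<close> is defined on \<open>xs\<close> with value \<open>y\<close>.
\<close>

datatype recf =
    ZeroF
  | SuccF
  | ProjF nat
  | CompF recf "recf list"
  | PrimF recf recf
  | MinF recf

inductive rec_eval :: "recf \<Rightarrow> nat list \<Rightarrow> nat \<Rightarrow> bool" where
  zero: "rec_eval ZeroF xs 0"
| succ: "rec_eval SuccF [x] (Suc x)"
| proj: "i < length xs \<Longrightarrow> rec_eval (ProjF i) xs (xs ! i)"
| comp: "length ys = length gs \<Longrightarrow> (\<forall>i<length gs. rec_eval (gs ! i) xs (ys ! i)) \<Longrightarrow>
    rec_eval f ys z \<Longrightarrow> rec_eval (CompF f gs) xs z"
| prim_0: "rec_eval f xs y \<Longrightarrow> rec_eval (PrimF f g) (0 # xs) y"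
| prim_Suc: "rec_eval (PrimF f g) (n # xs) r \<Longrightarrow> rec_eval g (n # r # xs) y \<Longrightarrow>
    rec_eval (PrimF f g) (Suc n # xs) y"
| min: "rec_eval f (n # xs) 0 \<Longrightarrow> (\<forall>m<n. \<exists>y. rec_eval f (m # xs) (Suc y)) \<Longrightarrow>
    rec_eval (MinF f) xs n"

lemma rec_eval_functional: "rec_eval f xs y \<Longrightarrow> rec_eval f xs y' \<Longrightarrow> y = y'"
proof (induction arbitrary: y' rule: rec_eval.induct)
  case (comp ys gs xs f z)
  from comp.prems obtain ys' where ys': "length ys' = length gs"
    "\<forall>i<length gs. rec_eval (gs ! i) xs (ys' ! i)" "rec_eval f ys' y'"
    by (cases rule: rec_eval.cases) auto
  have "ys = ys'"
    using comp.hyps comp.IH ys' by (intro nth_equalityI) auto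
  then show ?case using ys' comp.IH by blast
next
  case (prim_Suc f g n xs r y)
  from prim_Suc.prems obtain r' where "rec_eval (PrimF f g) (n # xs) r'" "rec_eval g (n # r' # xs) y'"
    by (cases rule: rec_eval.cases) auto
  then show ?case using prim_Suc.IH by blast
next
  case (min f n xs)
  from min.prems have "rec_eval f (y' # xs) 0 \<and> (\<forall>m<y'. \<exists>y. rec_eval f (m # xs) (Suc y))"
    by (cases rule: rec_eval.cases) simp
  then have y': "rec_eval f (y' # xs) 0" "\<forall>m<y'. \<exists>y. rec_eval f (m # xs) (Suc y)"
    by blast+
  show ?case
  proof (rule linorder_cases)
    assume "n < y'"
    then obtain y where "rec_eval f (n # xs) (Suc y)" using y'(2) by blast
    then show ?thesis using min.IH(1) by blast
  next
    assume "y' < n"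
    then obtain y where "\<And>v. rec_eval f (y' # xs) v \<Longrightarrow> Suc y = v" using min.IH(2) by blast
    then show ?thesis using y'(1) by blast
  qed
next
  case (zero xs)
  then show ?case by (cases rule: rec_eval.cases) simp
next
  case (succ x)
  then show ?case by (cases rule: rec_eval.cases) simp
next
  case (proj i xs)
  from proj.prems show ?case by (cases rule: rec_eval.cases) auto
next
  case (prim_0 f xs y g)
  from prim_0.prems have "rec_eval f xs y'" by (cases rule: rec_eval.cases) auto
  then show ?case using prim_0.IH by blast
qed

text \<open>
  A decision problem has an encoding of inputs, a set \<open>D\<close> of admissible inputs and a question \<open>P\<close>.
  On codes of inadmissible inputs, and on numbers that are no codes, a decision procedure may behave
  arbitrarily.
\<close>

definition decidable_problem :: "('a \<Rightarrow> nat) \<Rightarrow> 'a set \<Rightarrow> ('a \<Rightarrow> bool) \<Rightarrow> bool" where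
  "decidable_problem enc D P \<longleftrightarrow>
     (\<exists>f. \<forall>x\<in>D. rec_eval f [enc x] (if P x then 1 else 0))"


section \<open>Encoding of inputs\<close>

fun enc_trm :: "trm \<Rightarrow> nat" where
  "enc_trm (Var x) = prod_encode (0, x)"
| "enc_trm (Const c) = prod_encode (1, c)"
| "enc_trm (Null n) = prod_encode (2, n)"

fun enc_predsym :: "predsym \<Rightarrow> nat" where
  "enc_predsym (Pred p n) = prod_encode (p, n)"

fun enc_atom :: "atom \<Rightarrow> nat" where
  "enc_atom (Atom p ts) = prod_encode (enc_predsym p, list_encode (map enc_trm ts))"

fun enc_rule :: "rule \<Rightarrow> nat" where
  "enc_rule (Rule B N zs H) =
     list_encode
       [list_encode (map enc_atom B), list_encode (map enc_atom N),
        list_encode zs, list_encode (map enc_atom H)]"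

fun enc_input :: "rule list \<times> rule \<times> rule \<Rightarrow> nat" where
  "enc_input (rs, \<rho>\<^sub>1, \<rho>\<^sub>2) =
     list_encode [list_encode (map enc_rule rs), enc_rule \<rho>\<^sub>1, enc_rule \<rho>\<^sub>2]"

lemma inj_enc_trm: "inj enc_trm"
proof (rule injI)
  fix s t show "enc_trm s = enc_trm t \<Longrightarrow> s = t"
    by (cases s; cases t) simp_all
qed

lemma inj_enc_atom: "inj enc_atom"
proof (rule injI)
  fix a b :: atom
  obtain p n ts q m us where "a = Atom (Pred p n) ts" "b = Atom (Pred q m) us"
    by (metis atom.exhaust predsym.exhaust)
  then show "enc_atom a = enc_atom b \<Longrightarrow> a = b"
    by (simp add: list_encode_eq inj_map_eq_map[OF inj_enc_trm])
qed

lemma inj_enc_rule: "inj enc_rule"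
proof (rule injI)
  fix a b show "enc_rule a = enc_rule b \<Longrightarrow> a = b"
    by (cases a; cases b) (simp del: list_encode.simps add: list_encode_eq inj_map_eq_map[OF inj_enc_atom])
qed

lemma inj_enc_input: "inj enc_input"
  by (auto intro!: injI simp del: list_encode.simps
      simp: list_encode_eq inj_map_eq_map[OF inj_enc_rule] inj_eq[OF inj_enc_rule])

end

theory Submission
  imports Defs
begin

text \<open>
  The defining clauses of a partial recursive function \<open>h\<close> are Horn clauses. Together with a rule that
  creates a successor of each number they form a positive ruleset whose chase evaluates \<open>h\<close>.

  Since a trail may use any database, facts must not be given in advance. The nullary start rule
  \<open>\<not>Bad \<longrightarrow> Started\<close> enables all other rules, and for each predicate \<open>p\<close> of the clauses a rule
  \<open>p(xs) \<and> \<not>Started \<longrightarrow> Bad\<close> forces, by fairness, \<open>Bad\<close> on every chase whose initial database has a fact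
  for \<open>p\<close>; a generating chase that applies the start rule avoids \<open>Bad\<close>. So the start rule followed by
  the stop rule \<open>Started \<and> Accept \<longrightarrow> Done\<close> is a trail iff \<open>h(n) = 0\<close>, where one further rule provides
  the input \<open>n\<close>. Both rules have no variables, hence the labelling is irrelevant.

  A decision procedure \<open>d\<close> is refuted without a universal function: let \<open>h(n)\<close> apply \<open>d\<close> to the code of
  the ruleset obtained by adding the rule for the input \<open>n\<close> to the list of rules with code \<open>n\<close>, and
  let \<open>n\<close> be the code of the rules for \<open>h\<close>.
\<close>

section \<open>Computing the code of an input\<close>

text \<open>Only lists of length \<open>k\<close> are constrained, so the arguments of
  \<open>F\<close> can be addressed by \<open>!\<close>, \<open>hd\<close> and
  \<open>tl\<close>.\<close>

definition computable :: "nat \<Rightarrow> (nat list \<Rightarrow> nat) \<Rightarrow> bool" where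
  "computable k F \<longleftrightarrow> (\<exists>f. \<forall>xs. length xs = k \<longrightarrow> rec_eval f xs (F xs))"

lemma computable_comp:
  assumes "computable (length Gs) F" and "\<And>G. G \<in> set Gs \<Longrightarrow> computable k G"
  shows "computable k (\<lambda>xs. F (map (\<lambda>G. G xs) Gs))"
proof -
  obtain f where f: "rec_eval f ys (F ys)" if "length ys = length Gs" for ys
    using assms(1) by (auto simp: computable_def)
  have "\<exists>c. \<forall>G\<in>set Gs. \<forall>xs. length xs = k \<longrightarrow> rec_eval (c G) xs (G xs)"
    using assms(2) by (intro bchoice) (auto simp: computable_def)
  then obtain c where c: "rec_eval (c G) xs (G xs)" if "G \<in> set Gs" "length xs = k" for G xs
    by blast
  have "rec_eval (CompF f (map c Gs)) xs (F (map (\<lambda>G. G xs) Gs))" if "length xs = k" for xs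
    using that by (intro rec_eval.comp[OF _ _ f]) (auto intro: c)
  then show ?thesis unfolding computable_def by blast
qed

lemma computable_comp1:
  assumes "computable 1 F" and "computable k G"
  shows "computable k (\<lambda>xs. F [G xs])"
  using computable_comp[of "[G]" F k] assms by simp

lemma computable_comp2:
  assumes "computable 2 F" and "computable k G" and "computable k H"
  shows "computable k (\<lambda>xs. F [G xs, H xs])"
  using computable_comp[of "[G, H]" F k] assms by (auto simp: numeral_2_eq_2)

lemma computable_nth: "i < k \<Longrightarrow> computable k (\<lambda>xs. xs ! i)"
  unfolding computable_def by (intro exI[of _ "ProjF i"]) (auto intro: rec_eval.proj)

lemma computable_Suc:
  assumes "computable k F"
  shows "computable k (\<lambda>xs. Suc (F xs))"
proof -
  have "computable 1 (\<lambda>xs. Suc (xs ! 0))"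
    unfolding computable_def
    by (intro exI[of _ SuccF]) (auto simp: length_Suc_conv intro: rec_eval.succ)
  from computable_comp1[OF this assms] show ?thesis by simp
qed

lemma computable_const: "computable k (\<lambda>xs. c)"
proof (induction c)
  case 0
  show ?case unfolding computable_def by (blast intro: rec_eval.zero)
qed (rule computable_Suc)

text \<open>\<open>PrimF\<close> passes the counter, then the previous value, then the parameters to
  its step function; this fixes the argument order of \<open>G\<close>.\<close>

lemma computable_rec_nat:
  assumes "computable k F" and "computable (Suc (Suc k)) G"
  shows "computable (Suc k) (\<lambda>xs. rec_nat (F (tl xs)) (\<lambda>n r. G (n # r # tl xs)) (hd xs))"
proof -
  obtain f where f: "rec_eval f xs (F xs)" if "length xs = k" for xs
    using assms(1) by (auto simp: computable_def)
  obtain g where g: "rec_eval g xs (G xs)" if "length xs = Suc (Suc k)" for xs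
    using assms(2) by (auto simp: computable_def)
  have "rec_eval (PrimF f g) (n # xs) (rec_nat (F xs) (\<lambda>n r. G (n # r # xs)) n)"
    if "length xs = k" for n xs
  proof (induction n)
    case 0
    show ?case using f[OF that] by (auto intro: rec_eval.prim_0)
  next
    case (Suc n)
    then show ?case using that by (auto intro!: rec_eval.prim_Suc[OF Suc] g)
  qed
  then show ?thesis
    unfolding computable_def by (intro exI[of _ "PrimF f g"]) (auto simp: length_Suc_conv)
qed

lemma computable_add:
  assumes "computable k F" and "computable k G"
  shows "computable k (\<lambda>xs. F xs + G xs)"
proof -
  have rec: "rec_nat b (\<lambda>n. Suc) a = a + b" for a b
    by (induction a) auto
  have "computable 2 (\<lambda>xs. rec_nat (tl xs ! 0) (\<lambda>n r. Suc ((n # r # tl xs) ! 1)) (hd xs))"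
    unfolding numeral_2_eq_2
    by (rule computable_rec_nat computable_Suc computable_nth | simp)+
  from computable_comp2[OF this assms] show ?thesis by (simp add: rec)
qed

text \<open>\<open>prod_encode (a, b)\<close> is \<open>triangle (a + b) + a\<close>, and
  \<open>triangle\<close> is a primitive recursion.\<close>

lemma computable_prod_encode:
  assumes "computable k F" and "computable k G"
  shows "computable k (\<lambda>xs. prod_encode (F xs, G xs))"
proof -
  have rec: "rec_nat 0 (\<lambda>n r. r + Suc n) a = triangle a" for a
    by (induction a) auto
  have "computable (Suc 0)
    (\<lambda>xs. rec_nat 0 (\<lambda>n r. (n # r # tl xs) ! 1 + Suc ((n # r # tl xs) ! 0)) (hd xs))"
    by (rule computable_rec_nat[where F = "\<lambda>_. 0" and G = "\<lambda>xs. xs ! 1 + Suc (xs ! 0)"])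
      (intro computable_const computable_add computable_Suc computable_nth; simp)+
  from computable_comp1[OF this[folded One_nat_def] computable_add[OF assms]]
  have "computable k (\<lambda>xs. triangle (F xs + G xs))"
    using rec by simp
  from computable_add[OF this assms(1)] show ?thesis
    by (simp add: prod_encode_def)
qed

lemmas computable_intros =
  computable_prod_encode computable_add computable_Suc computable_nth computable_const


section \<open>Horn clauses for a partial recursive function\<close>

datatype symb =
  Started | Bad | Done | Accept | Number | Successor | Input | Value recf | Bounded recf

instance recf :: countable
  by countable_datatype

instance symb :: countable
  by countable_datatype

text \<open>The arity is read off the argument list: these atoms are well-formed by construction,
  and \<open>Value f\<close> at different lengths gives different predicates.\<close>

definition atm :: "symb \<Rightarrow> trm list \<Rightarrow> atom" where
  "atm s ts = Atom (Pred (to_nat s) (length ts)) ts"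

lemma atm_simps [simp]:
  "wf_atom (atm s ts)"
  "pred_of (atm s ts) = Pred (to_nat s) (length ts)"
  "args (atm s ts) = ts"
  "vars_atom (atm s ts) = {x. Var x \<in> set ts}"
  "nulls_atom (atm s ts) = {x. Null x \<in> set ts}"
  "atm s ts = atm s' ts' \<longleftrightarrow> s = s' \<and> ts = ts'"
  "subst_atom \<mu> (atm s ts) = atm s (map (subst_trm \<mu>) ts)"
  by (auto simp: atm_def wf_atom_def vars_atom_def nulls_atom_def subst_atom_def)

type_synonym clause = "atom list \<times> atom"

abbreviation params :: "nat \<Rightarrow> trm list" where
  "params k \<equiv> map Var [0..<k]"

abbreviation numbers :: "nat \<Rightarrow> atom list" where
  "numbers k \<equiv> map (\<lambda>i. atm Number [Var i]) [0..<k]"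

text \<open>
  \<open>Value f (y, xs)\<close> means that \<open>f\<close> has value \<open>y\<close> on \<open>xs\<close>, and \<open>Bounded f (n, xs)\<close> means that \<open>f\<close> has
  positive values on \<open>(m, xs)\<close> for all \<open>m < n\<close>. The argument \<open>k\<close> is the length of \<open>xs\<close>; zero is the
  constant \<open>Const 0\<close>.
\<close>

fun clauses :: "recf \<Rightarrow> nat \<Rightarrow> clause list" where
  "clauses ZeroF k = [(numbers k, atm (Value ZeroF) (Const 0 # params k))]"
| "clauses SuccF k = [([atm Successor [Var 0, Var 1]], atm (Value SuccF) [Var 1, Var 0])]"
| "clauses (ProjF i) k =
     (if i < k then [(numbers k, atm (Value (ProjF i)) (Var i # params k))] else [])"
| "clauses (CompF f gs) k =
     (numbers k @ atm (Value f) (Var (k + length gs) # map Var [k..<k + length gs]) #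
        map (\<lambda>j. atm (Value (gs ! j)) (Var (k + j) # params k)) [0..<length gs],
      atm (Value (CompF f gs)) (Var (k + length gs) # params k)) #
     clauses f (length gs) @ concat (map (\<lambda>g. clauses g k) gs)"
| "clauses (PrimF f g) 0 = []"
| "clauses (PrimF f g) (Suc k) =
     ([atm (Value f) (Var k # params k)], atm (Value (PrimF f g)) (Var k # Const 0 # params k)) #
     ([atm (Value (PrimF f g)) (Var (k + 2) # Var k # params k),
       atm Successor [Var k, Var (k + 1)],
       atm (Value g) (Var (k + 3) # Var k # Var (k + 2) # params k)],
      atm (Value (PrimF f g)) (Var (k + 3) # Var (k + 1) # params k)) #
     clauses f k @ clauses g (Suc (Suc k))"
| "clauses (MinF f) k =
     (numbers k, atm (Bounded f) (Const 0 # params k)) #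
     ([atm (Bounded f) (Var k # params k),
       atm Successor [Var k, Var (k + 1)],
       atm (Value f) (Var (k + 3) # Var k # params k),
       atm Successor [Var (k + 2), Var (k + 3)]],
      atm (Bounded f) (Var (k + 1) # params k)) #
     ([atm (Bounded f) (Var k # params k), atm (Value f) (Const 0 # Var k # params k)],
      atm (Value (MinF f)) (Var k # params k)) #
     clauses f (Suc k)"

text \<open>The last conjunct is safety; the atoms \<open>numbers k\<close> in clause bodies are
  there to bind the parameters. \<open>Started\<close>, \<open>Bad\<close> and \<open>Done\<close>
  are reserved for the control rules.\<close>

definition wf_clause :: "clause \<Rightarrow> bool" where
  "wf_clause c \<longleftrightarrow>
     (\<forall>a\<in>insert (snd c) (set (fst c)). \<exists>s ts. a = atm s ts \<and> s \<notin> {Started, Bad, Done} \<and>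
        (\<forall>x. Null x \<notin> set ts)) \<and>
     vars_atom (snd c) \<subseteq> vars_atoms (set (fst c))"

lemma wf_clauses: "\<forall>c\<in>set (clauses f k). wf_clause c"
proof (induction f k rule: clauses.induct)
  case (4 f gs k)
  have "wf_clause
    (numbers k @ atm (Value f) (Var (k + length gs) # map Var [k..<k + length gs]) #
       map (\<lambda>j. atm (Value (gs ! j)) (Var (k + j) # params k)) [0..<length gs],
     atm (Value (CompF f gs)) (Var (k + length gs) # params k))"
    by (auto simp: wf_clause_def vars_atoms_def Bex_def)
  with 4 show ?case by auto
qed (auto simp: wf_clause_def vars_atoms_def Bex_def)

text \<open>The intended model over the natural numbers. \<open>Input\<close> relates every
  \<open>x\<close> to \<open>x + n\<close> because the input clause walks \<open>n\<close> successor
  edges from an arbitrary number; the clause for \<open>Accept\<close> fixes the start to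
  zero.\<close>

definition holds :: "recf \<Rightarrow> nat \<Rightarrow> symb \<Rightarrow> nat list \<Rightarrow> bool" where
  "holds h n s xs \<longleftrightarrow>
     (case s of
        Accept \<Rightarrow> rec_eval h [n] 0
      | Successor \<Rightarrow> \<exists>x. xs = [x, Suc x]
      | Input \<Rightarrow> \<exists>x. xs = [x, x + n]
      | Value f \<Rightarrow> \<exists>y ys. xs = y # ys \<and> rec_eval f ys y
      | Bounded f \<Rightarrow> \<exists>i ys. xs = i # ys \<and> (\<forall>m<i. \<exists>y. rec_eval f (m # ys) (Suc y))
      | _ \<Rightarrow> True)"

text \<open>A single \<open>v\<close> values variables, constants and nulls, so that applying a
  substitution amounts to composing \<open>v\<close> with it.\<close>

definition true_atom :: "recf \<Rightarrow> nat \<Rightarrow> (trm \<Rightarrow> nat) \<Rightarrow> atom \<Rightarrow> bool" where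
  "true_atom h n v a \<longleftrightarrow> (case pred_of a of Pred p _ \<Rightarrow> holds h n (from_nat p) (map v (args a)))"

lemma true_atom_atm [simp]: "true_atom h n v (atm s ts) \<longleftrightarrow> holds h n s (map v ts)"
  by (simp add: true_atom_def)

lemma true_atom_subst_atom:
  "true_atom h n v (subst_atom \<mu> a) \<longleftrightarrow> true_atom h n (v \<circ> subst_trm \<mu>) a"
  by (simp add: true_atom_def subst_atom_def split: predsym.split)

lemma true_atom_cong:
  "(\<And>t. t \<in> set (args a) \<Longrightarrow> v t = w t) \<Longrightarrow> true_atom h n v a \<longleftrightarrow> true_atom h n w a"
  by (simp add: true_atom_def split: predsym.split cong: map_cong)

definition valid :: "recf \<Rightarrow> nat \<Rightarrow> clause \<Rightarrow> bool" where
  "valid h n c \<longleftrightarrow>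
     (\<forall>v. v (Const 0) = 0 \<longrightarrow> (\<forall>a\<in>set (fst c). true_atom h n v a) \<longrightarrow> true_atom h n v (snd c))"

text \<open>Each clause mirrors an introduction rule of \<open>rec_eval\<close>, except that
  \<open>Bounded\<close> builds up the universal premise of \<open>rec_eval.min\<close> one number
  at a time.\<close>

lemma valid_clauses: "\<forall>c\<in>set (clauses f k). valid h n c"
proof (induction f k rule: clauses.induct)
  case (4 f gs k)
  have "valid h n
    (numbers k @ atm (Value f) (Var (k + length gs) # map Var [k..<k + length gs]) #
       map (\<lambda>j. atm (Value (gs ! j)) (Var (k + j) # params k)) [0..<length gs],
     atm (Value (CompF f gs)) (Var (k + length gs) # params k))"
    unfolding valid_def
  proof (intro allI impI, unfold fst_conv snd_conv)
    fix v
    assume "\<forall>a\<in>set (numbers k @ atm (Value f) (Var (k + length gs) # map Var [k..<k + length gs]) #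
      map (\<lambda>j. atm (Value (gs ! j)) (Var (k + j) # params k)) [0..<length gs]). true_atom h n v a"
    then show "true_atom h n v (atm (Value (CompF f gs)) (Var (k + length gs) # params k))"
      by (auto simp: holds_def ball_Un
          intro!: rec_eval.comp[where ys = "map (\<lambda>i. v (Var i)) [k..<k + length gs]"] simp: o_def)
  qed
  with 4 show ?case by auto
next
  case (3 i k)
  have "rec_eval (ProjF i) (map v (params k)) (v (Var i))" if "i < k" for v
    using rec_eval.proj[of i "map v (params k)"] that by simp
  then show ?case by (auto simp: valid_def holds_def o_def)
qed (auto simp: valid_def holds_def o_def less_Suc_eq
    intro: rec_eval.zero rec_eval.succ rec_eval.prim_0 rec_eval.prim_Suc rec_eval.min)

section \<open>Completeness of the clauses\<close>

abbreviation ground :: "(nat \<Rightarrow> trm) \<Rightarrow> subst" where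
  "ground \<sigma> \<equiv> \<lambda>x. Some (\<sigma> x)"

definition closed_under :: "db \<Rightarrow> clause \<Rightarrow> bool" where
  "closed_under J c \<longleftrightarrow>
     (\<forall>\<sigma>. subst_atom (ground \<sigma>) ` set (fst c) \<subseteq> J \<longrightarrow> subst_atom (ground \<sigma>) (snd c) \<in> J)"

lemma closed_underD:
  "closed_under J c \<Longrightarrow> (\<forall>a\<in>set (fst c). subst_atom (ground \<sigma>) a \<in> J) \<longrightarrow>
   subst_atom (ground \<sigma>) (snd c) \<in> J"
  unfolding closed_under_def by blast

lemma map_append_nth:
  "map (\<lambda>i. t ((xs @ ys) ! i)) [0..<length xs] = map t xs"
  "map (\<lambda>i. t ((xs @ ys @ zs) ! i)) [length xs..<length xs + length ys] = map t ys"
  by (auto intro!: nth_equalityI simp: nth_append)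

lemma nth_append_offset:
  "(xs @ ys) ! Suc (length xs) = ys ! 1"
  "(xs @ ys) ! Suc (Suc (length xs)) = ys ! 2"
  "(xs @ ys) ! (length xs + 3) = ys ! 3"
  by (simp_all add: nth_append numeral_2_eq_2)

text \<open>Induction on the evaluation; the clauses for \<open>f\<close> include those for its
  subfunctions. The terms \<open>t i\<close> stand for numbers: in the chase, for
  \<open>Const 0\<close> and its iterated successors.\<close>

lemma clauses_complete:
  assumes "rec_eval f xs y" and "\<forall>c\<in>set (clauses f (length xs)). closed_under J c"
    and t: "t 0 = Const 0" "\<And>i. atm Number [t i] \<in> J" "\<And>i. atm Successor [t i, t (Suc i)] \<in> J"
  shows "atm (Value f) (map t (y # xs)) \<in> J"
  using assms(1,2)
proof (induction rule: rec_eval.induct)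
  case (zero xs)
  then have "closed_under J (numbers (length xs), atm (Value ZeroF) (Const 0 # params (length xs)))"
    by simp
  \<comment> \<open>Parameters are numbered first and auxiliary variables after them, so an instance
    of a clause is given by the list of the values. The empty suffix produces the shape of
    \<open>map_append_nth\<close>.\<close>
  from closed_underD[OF this, of "\<lambda>i. t ((xs @ []) ! i)"]
  show ?case using t by (auto simp: o_def map_append_nth simp del: append_Nil2)
next
  case (succ x)
  then have "closed_under J ([atm Successor [Var 0, Var 1]], atm (Value SuccF) [Var 1, Var 0])"
    by simp
  from closed_underD[OF this, of "\<lambda>i. t ([x, Suc x] ! i)"] show ?case using t by simp
next
  case (proj i xs)
  then have "closed_under J (numbers (length xs), atm (Value (ProjF i)) (Var i # params (length xs)))"
    by simp
  from closed_underD[OF this, of "\<lambda>i. t ((xs @ []) ! i)"]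
  show ?case using t by (auto simp: o_def map_append_nth simp del: append_Nil2) simp
next
  case (comp ys gs xs f z)
  let ?k = "length xs" and ?m = "length gs"
  have c: "closed_under J
    (numbers ?k @ atm (Value f) (Var (?k + ?m) # map Var [?k..<?k + ?m]) #
        map (\<lambda>j. atm (Value (gs ! j)) (Var (?k + j) # params ?k)) [0..<?m],
      atm (Value (CompF f gs)) (Var (?k + ?m) # params ?k))"
    using comp.prems by simp
  have f: "atm (Value f) (map t (z # ys)) \<in> J"
    using comp by simp
  have g: "atm (Value (gs ! j)) (map t ((ys ! j) # xs)) \<in> J" if "j < ?m" for j
  proof -
    have "\<forall>c\<in>set (clauses (gs ! j) ?k). closed_under J c" 
      using comp.prems that by (auto simp: nth_mem)
    then show ?thesis using comp.IH(1) that by blast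
  qed
  have z: "(xs @ ys @ [z]) ! (?k + length ys) = z"
    by (auto simp: nth_append)
  have y: "(ys @ [z]) ! j = ys ! j" if "j < length ys" for j
    using that by (auto simp: nth_append)
  show ?case
    using closed_underD[OF c, of "\<lambda>i. t ((xs @ ys @ [z]) ! i)"] t f g
    by (auto simp: o_def map_append_nth ball_Un z y simp flip: comp.hyps(1))
next
  case (prim_0 f xs y g)
  have c: "closed_under J ([atm (Value f) (Var (length xs) # params (length xs))],
    atm (Value (PrimF f g)) (Var (length xs) # Const 0 # params (length xs)))"
    using prim_0.prems by simp
  show ?case
    using closed_underD[OF c, of "\<lambda>i. t ((xs @ [y]) ! i)"] t prim_0
    by (auto simp: o_def map_append_nth)
next
  case (prim_Suc f g n xs r y)
  let ?k = "length xs"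
  have c: "closed_under J
    ([atm (Value (PrimF f g)) (Var (?k + 2) # Var ?k # params ?k),
       atm Successor [Var ?k, Var (?k + 1)],
       atm (Value g) (Var (?k + 3) # Var ?k # Var (?k + 2) # params ?k)],
      atm (Value (PrimF f g)) (Var (?k + 3) # Var (?k + 1) # params ?k))"
    using prim_Suc.prems by simp
  show ?case
    using closed_underD[OF c, of "\<lambda>i. t ((xs @ [n, Suc n, r, y]) ! i)"] t prim_Suc
    by (auto simp: o_def map_append_nth nth_append_offset)
next
  case (min f n xs)
  let ?k = "length xs"
  have c: "closed_under J (numbers ?k, atm (Bounded f) (Const 0 # params ?k))"
    "closed_under J
      ([atm (Bounded f) (Var ?k # params ?k),
       atm Successor [Var ?k, Var (?k + 1)],
       atm (Value f) (Var (?k + 3) # Var ?k # params ?k),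
       atm Successor [Var (?k + 2), Var (?k + 3)]],
      atm (Bounded f) (Var (?k + 1) # params ?k))"
    "closed_under J
      ([atm (Bounded f) (Var ?k # params ?k), atm (Value f) (Const 0 # Var ?k # params ?k)],
       atm (Value (MinF f)) (Var ?k # params ?k))"
    using min.prems by simp_all
  have sub: "\<forall>c\<in>set (clauses f (Suc ?k)). closed_under J c"
    using min.prems by simp
  \<comment> \<open>The second clause for \<open>Bounded\<close> is climbed along the successor
    edges, from zero up to \<open>n\<close>.\<close>
  have "atm (Bounded f) (map t (m # xs)) \<in> J" if "m \<le> n" for m
    using that
  proof (induction m)
    case 0
    show ?case
      using closed_underD[OF c(1), of "\<lambda>i. t ((xs @ []) ! i)"] t
      by (auto simp: o_def map_append_nth simp del: append_Nil2)
  next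
    case (Suc m)
    then obtain y where "atm (Value f) (map t (Suc y # m # xs)) \<in> J"
      using min.IH(2) sub by (metis Suc_le_lessD length_Cons)
    then show ?case
      \<comment> \<open>That the value is positive is expressed by its having a predecessor, hence
        the entries \<open>y\<close> and \<open>Suc y\<close>.\<close>
      using closed_underD[OF c(2), of "\<lambda>i. t ((xs @ [m, Suc m, y, Suc y]) ! i)"] t Suc
      by (auto simp: o_def map_append_nth nth_append_offset)
  qed
  then show ?case
    using closed_underD[OF c(3), of "\<lambda>i. t ((xs @ [n]) ! i)"] t min.IH(1) sub
    by (auto simp: o_def map_append_nth)
qed


section \<open>The chase of a positive ruleset\<close>

lemma finite_vars_atom: "finite (vars_atom a)"
  and finite_nulls_atom: "finite (nulls_atom a)"
proof -
  have "finite (Var -` set (args a))" "finite (Null -` set (args a))"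
    by (intro finite_vimageI; simp add: inj_on_def)+
  then show "finite (vars_atom a)" "finite (nulls_atom a)"
    by (simp_all add: vars_atom_def nulls_atom_def vimage_def)
qed

lemma finite_uvars: "finite (uvars \<rho>)"
  by (simp add: uvars_def vars_rule_def vars_atoms_def pbody_def nbody_def head_def evars_def
      finite_vars_atom)

lemma uvars_Un_evars: "uvars \<rho> \<union> evars \<rho> = vars_rule \<rho>"
  by (auto simp: uvars_def vars_rule_def)

lemma subst_atom_cong:
  "(\<And>x. x \<in> vars_atom a \<Longrightarrow> \<mu> x = \<nu> x) \<Longrightarrow> subst_atom \<mu> a = subst_atom \<nu> a"
proof -
  assume "\<And>x. x \<in> vars_atom a \<Longrightarrow> \<mu> x = \<nu> x"
  then have "subst_trm \<mu> t = subst_trm \<nu> t" if "t \<in> set (args a)" for t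
    using that by (cases t) (simp_all add: vars_atom_def)
  then show ?thesis by (simp add: subst_atom_def)
qed

lemma is_match_mono: "nbody \<rho> = {} \<Longrightarrow> is_match I \<rho> \<mu> \<Longrightarrow> I \<subseteq> J \<Longrightarrow> is_match J \<rho> \<mu>"
  by (auto simp: is_match_def)

lemma satisfied_mono: "satisfied I \<rho> \<mu> \<Longrightarrow> I \<subseteq> J \<Longrightarrow> satisfied J \<rho> \<mu>"
  unfolding satisfied_def by blast

lemma satisfied_no_evars: "evars \<rho> = {} \<Longrightarrow> satisfied I \<rho> \<mu> \<longleftrightarrow> subst_atom \<mu> ` head \<rho> \<subseteq> I"
  by (auto simp: satisfied_def)

lemma applied_satisfied:
  assumes "applied J \<rho> \<mu> K"
  shows "satisfied K \<rho> (\<mu> |` uvars \<rho>)"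
proof -
  have "\<mu> |` uvars \<rho> ++ \<mu> |` evars \<rho> = \<mu>"
  proof
    fix x show "(\<mu> |` uvars \<rho> ++ \<mu> |` evars \<rho>) x = \<mu> x"
      using assms uvars_Un_evars[of \<rho>]
      by (auto simp: applied_def map_add_def restrict_map_def dom_def split: option.splits)
  qed
  moreover have "dom (\<mu> |` evars \<rho>) = evars \<rho>"
    using assms uvars_Un_evars[of \<rho>] by (auto simp: applied_def)
  ultimately show ?thesis
    using assms unfolding satisfied_def by (intro exI[of _ "\<mu> |` evars \<rho>"]) (auto simp: applied_def)
qed

text \<open>Without negation a match survives every growth of the database, so always applying an
  unsatisfied match of least rank is fair. A finite database leaves nulls for fresh values.\<close>

locale positive_ruleset =
  fixes R :: "rule set" and I :: db
  assumes positive: "\<And>\<rho>. \<rho> \<in> R \<Longrightarrow> nbody \<rho> = {}"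
    and finite_db: "finite I"
begin

definition active :: "db \<Rightarrow> (rule \<times> subst) set" where
  "active J = {(\<rho>, \<mu>). \<rho> \<in> R \<and> is_match J \<rho> \<mu> \<and> \<not> satisfied J \<rho> \<mu>}"

text \<open>A numbering of matches, injective by \<open>rank_inject\<close>; hence only finitely
  many matches have a rank below a given one.\<close>

definition rank :: "rule \<times> subst \<Rightarrow> nat" where
  "rank = (\<lambda>(\<rho>, \<mu>). prod_encode (enc_rule \<rho>,
     list_encode (map (enc_trm \<circ> the \<circ> \<mu>) (sorted_list_of_set (uvars \<rho>)))))"

definition pick :: "db \<Rightarrow> rule \<times> subst" where
  "pick J = arg_min rank (\<lambda>m. m \<in> active J)"

text \<open>Such a bound exists for finite \<open>J\<close>. Adding the number of each existential
  variable to it gives distinct fresh nulls in \<open>extension\<close>.\<close>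

definition fresh :: "db \<Rightarrow> nat" where
  "fresh J = (SOME b. \<forall>n\<in>nulls_atoms J. n < b)"

definition extension :: "db \<Rightarrow> subst" where
  "extension J =
     snd (pick J) ++ (\<lambda>z. Some (Null (fresh J + z))) |` evars (fst (pick J))"

text \<open>Once no match is active, \<open>pick\<close> is arbitrary; the sequence is meaningful
  only up to \<open>seq_len\<close>.\<close>

primrec seq :: "nat \<Rightarrow> db" where
  "seq 0 = I"
| "seq (Suc i) = seq i \<union> subst_atom (extension (seq i)) ` head (fst (pick (seq i)))"

definition seq_len :: enat where
  "seq_len = (if \<exists>i. active (seq i) = {} then enat (LEAST i. active (seq i) = {}) else \<infinity>)"

definition seq_chase :: chase where
  "seq_chase = Chase seq_len seq (\<lambda>i. fst (pick (seq (i - 1)))) (\<lambda>i. extension (seq (i - 1)))"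

lemma rank_inject:
  assumes "rank (\<rho>, \<mu>) = rank (\<rho>', \<mu>')" and "dom \<mu> = uvars \<rho>" and "dom \<mu>' = uvars \<rho>'"
  shows "\<rho> = \<rho>'" and "\<mu> = \<mu>'"
proof -
  show \<rho>: "\<rho> = \<rho>'"
    using assms(1) by (simp add: rank_def inj_eq[OF inj_enc_rule])
  have "\<forall>x\<in>uvars \<rho>. the (\<mu> x) = the (\<mu>' x)"
    using assms(1) finite_uvars
    by (auto simp: rank_def \<rho> list_encode_eq inj_eq[OF inj_enc_trm])
  then show "\<mu> = \<mu>'"
    using assms(2,3) \<rho> by (intro ext) (metis domIff option.expand)
qed

lemma pick_active: "active J \<noteq> {} \<Longrightarrow> pick J \<in> active J"
  unfolding pick_def by (metis arg_min_nat_lemma ex_in_conv)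

lemma pick_le: "m \<in> active J \<Longrightarrow> rank (pick J) \<le> rank m"
  unfolding pick_def by (rule arg_min_nat_le)

lemma finite_seq: "finite (seq i)"
  by (induction i) (simp_all add: finite_db head_def)

lemma seq_mono: "i \<le> j \<Longrightarrow> seq i \<subseteq> seq j"
  by (rule lift_Suc_mono_le) auto

lemma fresh: "finite J \<Longrightarrow> n \<in> nulls_atoms J \<Longrightarrow> n < fresh J"
proof -
  assume J: "finite J" and n: "n \<in> nulls_atoms J"
  from J have "finite (nulls_atoms J)"
    by (simp add: nulls_atoms_def finite_nulls_atom)
  then have "\<forall>n\<in>nulls_atoms J. n < fresh J"
    unfolding fresh_def finite_nat_set_iff_bounded by (rule someI_ex)
  with n show ?thesis by blast
qed

lemma extension_restrict:
  assumes "active J \<noteq> {}"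
  shows "extension J |` uvars (fst (pick J)) = snd (pick J)"
proof
  fix x
  have "dom (snd (pick J)) = uvars (fst (pick J))"
    using pick_active[OF assms] by (simp add: active_def is_match_def split: prod.splits)
  then show "(extension J |` uvars (fst (pick J))) x = snd (pick J) x"
    by (cases "x \<in> uvars (fst (pick J))")
      (auto simp: extension_def map_add_def restrict_map_def uvars_def split: option.splits)
qed

lemma applied_pick:
  assumes "active (seq i) \<noteq> {}"
  shows "applied (seq i) (fst (pick (seq i))) (extension (seq i)) (seq (Suc i))"
proof -
  let ?\<rho> = "fst (pick (seq i))" and ?\<mu> = "snd (pick (seq i))" and ?e = "extension (seq i)"
  have m: "is_match (seq i) ?\<rho> ?\<mu>" and ns: "\<not> satisfied (seq i) ?\<rho> ?\<mu>"
    using pick_active[OF assms] by (auto simp: active_def split: prod.splits)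
  have ev: "?e z = Some (Null (fresh (seq i) + z))" if "z \<in> evars ?\<rho>" for z
    using that by (simp add: extension_def map_add_def)
  have "dom ?e = vars_rule ?\<rho>"
    using m uvars_Un_evars[of ?\<rho>] by (auto simp: extension_def is_match_def)
  moreover have "inj_on ?e (evars ?\<rho>)"
    by (auto simp: inj_on_def ev)
  moreover have "\<exists>n. ?e z = Some (Null n) \<and> n \<notin> nulls_atoms (seq i)" if "z \<in> evars ?\<rho>" for z
    using that fresh[OF finite_seq, of "fresh (seq i) + z" i] by (auto simp: ev)
  ultimately show ?thesis
    using m ns by (simp add: applied_def extension_restrict[OF assms])
qed

lemma pick_not_active_later:
  assumes "active (seq i) \<noteq> {}" and "i < j"
  shows "pick (seq i) \<notin> active (seq j)"
proof -
  have "satisfied (seq (Suc i)) (fst (pick (seq i))) (extension (seq i) |` uvars (fst (pick (seq i))))"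
    by (rule applied_satisfied[OF applied_pick[OF assms(1)]])
  moreover have "extension (seq i) |` uvars (fst (pick (seq i))) = snd (pick (seq i))"
    by (rule extension_restrict[OF assms(1)])
  ultimately show ?thesis
    using satisfied_mono seq_mono[of "Suc i" j] assms(2) by (auto simp: active_def split: prod.splits)
qed

text \<open>A match violating fairness would stay active. At the end of a finite chase nothing is
  active; in an infinite chase the picks would be infinitely many distinct matches of bounded
  rank.\<close>

lemma is_chase_seq_chase: "is_chase I R seq_chase"
proof -
  have active: "active (seq i) \<noteq> {}" if "enat i < seq_len" for i
    using that not_less_Least[of i] by (auto simp: seq_len_def split: if_splits)
  have "\<exists>j\<ge>i. enat j \<le> seq_len \<and> satisfied (seq j) \<rho> \<mu>"
    if i: "enat i \<le> seq_len" and \<rho>: "\<rho> \<in> R" and match: "is_match (seq i) \<rho> \<mu>" for i \<rho> \<mu>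
  proof (rule ccontr)
    assume "\<not> ?thesis"
    then have act: "(\<rho>, \<mu>) \<in> active (seq j)" if "i \<le> j" "enat j \<le> seq_len" for j
      using that is_match_mono[OF positive[OF \<rho>] match seq_mono] \<rho> by (auto simp: active_def)
    show False
    proof (cases "\<exists>i. active (seq i) = {}")
      case True
      then have "active (seq (LEAST i. active (seq i) = {})) = {}"
        by (rule LeastI_ex)
      moreover have "seq_len = enat (LEAST i. active (seq i) = {})"
        using True by (simp add: seq_len_def)
      ultimately show False using act i by force
    next
      case False
      then have inf: "seq_len = \<infinity>" by (simp add: seq_len_def)
      have "inj_on (\<lambda>j. rank (pick (seq j))) {i..}"
      proof (rule linorder_inj_onI')
        fix j k :: nat assume "j < k"
        have "pick (seq j) \<in> active (seq j)" "pick (seq k) \<in> active (seq k)"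
          using False pick_active by auto
        moreover have "pick (seq j) \<noteq> pick (seq k)"
          using pick_not_active_later[OF _ \<open>j < k\<close>] False calculation by metis
        ultimately show "rank (pick (seq j)) \<noteq> rank (pick (seq k))"
          using rank_inject by (fastforce simp: active_def is_match_def)
      qed
      moreover have "(\<lambda>j. rank (pick (seq j))) ` {i..} \<subseteq> {..rank (\<rho>, \<mu>)}"
        using pick_le act inf by auto
      ultimately have "finite {i..}"
        by (meson finite_atMost inj_on_finite)
      then show False using infinite_Ici by blast
    qed
  qed
  moreover have "fst (pick (seq (i - 1))) \<in> R \<and>
      applied (seq (i - 1)) (fst (pick (seq (i - 1)))) (extension (seq (i - 1))) (seq i)"
    if "0 < i" "enat i \<le> seq_len" for i
  proof -
    from that have "enat (i - 1) < seq_len"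
      by (metis diff_less enat_ord_simps(2) less_le_trans zero_less_one)
    from active[OF this] have ne: "active (seq (i - 1)) \<noteq> {}" .
    show ?thesis using applied_pick[OF ne] pick_active[OF ne] that(1)
      by (auto simp: active_def)
  qed
  ultimately show ?thesis
    by (auto simp: is_chase_def seq_chase_def steps_def)
qed

end

section \<open>Properties of arbitrary chases\<close>

lemma chase_step:
  assumes "is_chase I R C" and "i \<in> steps C"
  shows "rule_at C i \<in> R" and "applied (db_at C (i - 1)) (rule_at C i) (sub_at C i) (db_at C i)"
  using assms unfolding is_chase_def by blast+

lemma chase_fair:
  assumes "is_chase I R C" and "\<rho> \<in> R" and "enat i \<le> len C" and "is_match (db_at C i) \<rho> \<mu>"
  obtains j where "i \<le> j" and "enat j \<le> len C" and "satisfied (db_at C j) \<rho> \<mu>"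
  using assms unfolding is_chase_def by blast

lemma chase_result_mem: "a \<in> chase_result C \<longleftrightarrow> (\<exists>i. enat i \<le> len C \<and> a \<in> db_at C i)"
  by (auto simp: chase_result_def)

lemma chase_mono:
  assumes "is_chase I R C" and "i \<le> j" and "enat j \<le> len C"
  shows "db_at C i \<subseteq> db_at C j"
  using assms(2,3)
proof (induction j rule: dec_induct)
  case (step j)
  then have "enat j \<le> len C" "Suc j \<in> steps C"
    by (auto simp: steps_def intro: order_trans[of _ "enat (Suc j)"])
  with step chase_step(2)[OF assms(1), of "Suc j"] show ?case
    by (auto simp: applied_def)
qed simp

text \<open>The step sought is the one that produces the first database containing
  \<open>a\<close>.\<close>

lemma new_fact:
  assumes "is_chase I R C" and "a \<in> chase_result C" and "a \<notin> I"
  shows "\<exists>i\<in>steps C. a \<in> subst_atom (sub_at C i) ` head (rule_at C i)"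
proof -
  define P where "P i \<longleftrightarrow> enat i \<le> len C \<and> a \<in> db_at C i" for i
  define i where "i = (LEAST i. P i)"
  have "\<exists>i. P i" using assms(2) by (auto simp: chase_result_mem P_def)
  then have i: "P i" unfolding i_def by (rule LeastI_ex)
  moreover have "i \<noteq> 0"
    using i assms(1,3) by (metis P_def is_chase_def)
  moreover have "\<not> P (i - 1)"
    unfolding i_def by (rule not_less_Least) (use \<open>i \<noteq> 0\<close> i_def in simp)
  moreover have "enat (i - 1) \<le> len C"
    using i by (auto simp: P_def intro: order_trans[of _ "enat i"])
  ultimately have "i \<in> steps C" "a \<in> db_at C i" "a \<notin> db_at C (i - 1)"
    by (auto simp: P_def steps_def)
  moreover note chase_step(2)[OF assms(1) \<open>i \<in> steps C\<close>]
  ultimately show ?thesis by (auto simp: applied_def)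
qed

lemma finite_subset_chase_result:
  assumes "is_chase I R C" and "finite A" and "A \<subseteq> chase_result C"
  shows "\<exists>i. enat i \<le> len C \<and> A \<subseteq> db_at C i"
  using assms(2,3)
proof (induction A)
  case empty
  show ?case by (intro exI[of _ 0]) (simp flip: zero_enat_def)
next
  case (insert a A)
  then obtain i j where "enat i \<le> len C" "A \<subseteq> db_at C i" "enat j \<le> len C" "a \<in> db_at C j"
    by (auto simp: chase_result_mem)
  moreover from this have "enat (max i j) \<le> len C" by (simp add: max_def)
  ultimately show ?case
    using chase_mono[OF assms(1), of i "max i j"] chase_mono[OF assms(1), of j "max i j"]
    by (intro exI[of _ "max i j"]) auto
qed

text \<open>The body is finite, so its instance already lies in one database of the chase, where
  fairness applies. The result is thus a model of the positive rules.\<close>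

lemma chase_result_satisfied:
  assumes "is_chase I R C" and "\<rho> \<in> R" and "wf_rule \<rho>" and "nbody \<rho> = {}"
    and "subst_atom (ground \<sigma>) ` pbody \<rho> \<subseteq> chase_result C"
  shows "satisfied (chase_result C) \<rho> (ground \<sigma> |` uvars \<rho>)"
proof -
  obtain i where i: "enat i \<le> len C" "subst_atom (ground \<sigma>) ` pbody \<rho> \<subseteq> db_at C i"
    using finite_subset_chase_result[OF assms(1) _ assms(5)] by (auto simp: pbody_def)
  \<comment> \<open>\<open>is_match\<close> demands the exact domain \<open>uvars \<rho>\<close>;
    the body of a well-formed rule has no existential variables, so the restriction changes nothing
    there.\<close>
  have "subst_atom (ground \<sigma> |` uvars \<rho>) a = subst_atom (ground \<sigma>) a" if "a \<in> pbody \<rho>" for a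
  proof (rule subst_atom_cong)
    fix x assume "x \<in> vars_atom a"
    with that assms(3) have "x \<in> uvars \<rho>"
      by (auto simp: wf_rule_def uvars_def vars_rule_def vars_atoms_def)
    then show "(ground \<sigma> |` uvars \<rho>) x = ground \<sigma> x" by simp
  qed
  with i assms(4) have "is_match (db_at C i) \<rho> (ground \<sigma> |` uvars \<rho>)"
    by (auto simp: is_match_def)
  with assms(1,2) i(1) obtain j where "enat j \<le> len C" "satisfied (db_at C j) \<rho> (ground \<sigma> |` uvars \<rho>)"
    by (rule chase_fair)
  moreover from this have "db_at C j \<subseteq> chase_result C"
    by (auto simp: chase_result_mem)
  ultimately show ?thesis by (metis satisfied_mono)
qed


section \<open>The ruleset\<close>

text \<open>\<open>Started\<close> in the body holds these rules back until the start rule has been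
  applied, and lets the stop rule use the head of the start rule, as a trail demands.\<close>

definition horn_rule :: "clause \<Rightarrow> rule" where
  "horn_rule c = Rule (fst c @ [atm Started []]) [] [] [snd c]"

definition start_rule :: rule where
  "start_rule = Rule [] [atm Bad []] [] [atm Started []]"

definition stop_rule :: rule where
  "stop_rule = horn_rule ([atm Accept []], atm Done [])"

definition successor_rule :: rule where
  "successor_rule = Rule [atm Number [Var 0], atm Started []] [] [1]
     [atm Successor [Var 0, Var 1], atm Number [Var 1]]"

text \<open>The arguments are distinct variables, so every well-formed fact for \<open>p\<close> is
  an instance of the body.\<close>

definition guard_rule :: "predsym \<Rightarrow> rule" where
  "guard_rule p = Rule [Atom p (params (arity p))] [atm Started []] [] [atm Bad []]"

text \<open>Each increment of \<open>n\<close> puts one atom in front, which makes the code of the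
  body a primitive recursion.\<close>

primrec input_body :: "nat \<Rightarrow> atom list" where
  "input_body 0 = [atm Number [Var 0]]"
| "input_body (Suc n) = atm Successor [Var n, Var (Suc n)] # input_body n"

definition input_clause :: "nat \<Rightarrow> clause" where
  "input_clause n = (input_body n, atm Input [Var 0, Var n])"

text \<open>Nothing here depends on the input, so the code of the resulting rules can itself serve
  as the input.\<close>

definition base_clauses :: "recf \<Rightarrow> clause list" where
  "base_clauses h =
     ([], atm Number [Const 0]) #
     ([atm Input [Const 0, Var 0], atm (Value h) [Const 0, Var 0]], atm Accept []) #
     clauses h 1"

text \<open>\<open>Successor\<close> may be absent from the clauses for \<open>h\<close> but can
  occur in the input clause; listing it covers that clause for every \<open>n\<close> by one fixed
  list.\<close>

definition guarded :: "recf \<Rightarrow> predsym list" where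
  "guarded h =
     Pred (to_nat Number) 1 # Pred (to_nat Successor) 2 #
     map pred_of (concat (map (\<lambda>c. snd c # fst c) (base_clauses h)))"

definition base_rules :: "recf \<Rightarrow> rule list" where
  "base_rules h =
     start_rule # stop_rule # successor_rule #
     map horn_rule (base_clauses h) @ map guard_rule (guarded h)"

text \<open>With the input rule in front, the code of the list is
  \<open>Suc (prod_encode (r, c))\<close> for the codes \<open>r\<close> of the input rule and
  \<open>c\<close> of the base rules.\<close>

definition all_rules :: "recf \<Rightarrow> nat \<Rightarrow> rule list" where
  "all_rules h n = horn_rule (input_clause n) # base_rules h"

abbreviation all_clauses :: "recf \<Rightarrow> nat \<Rightarrow> clause set" where
  "all_clauses h n \<equiv> set (input_clause n # base_clauses h)"

section \<open>Syntactic properties of the ruleset\<close>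

lemma rule_cases [consumes 1, case_names start stop successor horn guard]:
  assumes "\<rho> \<in> set (all_rules h n)"
  obtains "\<rho> = start_rule" | "\<rho> = stop_rule" | "\<rho> = successor_rule"
  | c where "c \<in> all_clauses h n" and "\<rho> = horn_rule c"
  | p where "p \<in> set (guarded h)" and "\<rho> = guard_rule p"
proof -
  have "\<rho> = start_rule \<or> \<rho> = stop_rule \<or> \<rho> = successor_rule \<or>
      (\<exists>c\<in>all_clauses h n. \<rho> = horn_rule c) \<or> (\<exists>p\<in>set (guarded h). \<rho> = guard_rule p)"
    using assms by (auto simp: all_rules_def base_rules_def)
  then show thesis using that by blast
qed

lemma input_body_atoms:
  "a \<in> set (input_body n) \<Longrightarrow>
   (\<exists>i. a = atm Number [Var i]) \<or> (\<exists>i. a = atm Successor [Var i, Var (Suc i)])"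
  by (induction n) auto

lemma vars_input_body: "vars_atoms (set (input_body n)) = {..n}"
  by (induction n) (auto simp: vars_atoms_def)

lemma wf_all_clauses: "c \<in> all_clauses h n \<Longrightarrow> wf_clause c"
proof -
  have "wf_clause (input_clause n)"
    using vars_input_body[of n] by (auto simp: wf_clause_def input_clause_def dest!: input_body_atoms)
  then show "c \<in> all_clauses h n \<Longrightarrow> wf_clause c"
    using wf_clauses[of h 1] by (auto simp: base_clauses_def) (auto simp: wf_clause_def vars_atoms_def)
qed

lemma all_clauses_guarded:
  assumes "c \<in> all_clauses h n" and "a \<in> insert (snd c) (set (fst c))"
  shows "pred_of a \<in> set (guarded h)"
proof (cases "c = input_clause n")
  case True
  then show ?thesis
    using assms(2)
    by (auto simp: input_clause_def guarded_def base_clauses_def numeral_2_eq_2 dest!: input_body_atoms)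
next
  case False
  then show ?thesis using assms by (auto simp: guarded_def)
qed

lemma guarded_symbols:
  assumes "p \<in> set (guarded h)"
  obtains s k where "p = Pred (to_nat s) k" and "s \<notin> {Started, Bad, Done}"
proof -
  have "\<exists>s ts. a = atm s ts \<and> s \<notin> {Started, Bad, Done}"
    if "c \<in> set (base_clauses h)" "a \<in> insert (snd c) (set (fst c))" for c a
    using wf_all_clauses[of c 0 h] that by (auto simp: wf_clause_def)
  then have "\<exists>s k. p = Pred (to_nat s) k \<and> s \<notin> {Started, Bad, Done}"
    using assms unfolding guarded_def by fastforce
  then show thesis using that by blast
qed

lemma horn_rule_simps [simp]:
  "pbody (horn_rule c) = insert (atm Started []) (set (fst c))"
  "nbody (horn_rule c) = {}"
  "head (horn_rule c) = {snd c}"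
  "evars (horn_rule c) = {}"
  by (auto simp: horn_rule_def pbody_def nbody_def head_def evars_def)

lemma stop_rule_simps [simp]:
  "pbody stop_rule = {atm Started [], atm Accept []}"
  "nbody stop_rule = {}"
  "head stop_rule = {atm Done []}"
  "evars stop_rule = {}"
  by (simp_all add: stop_rule_def)

lemma start_rule_simps [simp]:
  "pbody start_rule = {}"
  "nbody start_rule = {atm Bad []}"
  "head start_rule = {atm Started []}"
  "evars start_rule = {}"
  by (simp_all add: start_rule_def pbody_def nbody_def head_def evars_def)

lemma successor_rule_simps [simp]:
  "pbody successor_rule = {atm Number [Var 0], atm Started []}"
  "nbody successor_rule = {}"
  "head successor_rule = {atm Successor [Var 0, Var 1], atm Number [Var 1]}"
  "evars successor_rule = {1}"
  by (simp_all add: successor_rule_def pbody_def nbody_def head_def evars_def)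

lemma guard_rule_simps [simp]:
  "pbody (guard_rule p) = {Atom p (params (arity p))}"
  "nbody (guard_rule p) = {atm Started []}"
  "head (guard_rule p) = {atm Bad []}"
  "evars (guard_rule p) = {}"
  by (simp_all add: guard_rule_def pbody_def nbody_def head_def evars_def)

lemma vars_rule_start_stop [simp]: "vars_rule start_rule = {}" "vars_rule stop_rule = {}"
  by (simp_all add: vars_rule_def vars_atoms_def)

lemma uvars_successor_rule [simp]: "uvars successor_rule = {0}"
  by (auto simp: uvars_def vars_rule_def vars_atoms_def)

lemma vars_atom_params [simp]: "vars_atom (Atom p (params k)) = {..<k}"
  by (auto simp: vars_atom_def)

lemma uvars_guard_rule [simp]: "uvars (guard_rule p) = {..<arity p}"
  by (auto simp: uvars_def vars_rule_def vars_atoms_def)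

lemma uvars_no_evars: "evars \<rho> = {} \<Longrightarrow> uvars \<rho> = vars_rule \<rho>"
  by (simp add: uvars_def)

lemma wf_horn_rule: "wf_clause c \<Longrightarrow> wf_rule (horn_rule c)"
  by (auto simp: wf_clause_def wf_rule_def vars_atoms_def)

lemma wf_all_rules:
  assumes "\<rho> \<in> set (all_rules h n)"
  shows "wf_rule \<rho>"
  using assms
proof (cases rule: rule_cases)
  case (guard p)
  then show ?thesis
    by (auto simp: wf_rule_def vars_atoms_def wf_atom_def nulls_atom_def)
qed (auto simp: wf_horn_rule wf_all_clauses, auto simp: wf_rule_def vars_atoms_def)

lemma is_ruleset_all_rules: "is_ruleset (set (all_rules h n))"
  by (simp add: is_ruleset_def wf_all_rules)

lemma rename_rule_start_stop [simp]:
  "rename_rule \<theta> start_rule = start_rule" "rename_rule \<theta> stop_rule = stop_rule"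
  by (simp_all add: rename_rule_def rename_atom_def start_rule_def stop_rule_def horn_rule_def)

lemma start_stop_in_rules: "start_rule \<in> set (all_rules h n)" "stop_rule \<in> set (all_rules h n)"
  by (simp_all add: all_rules_def base_rules_def)

lemma start_stop_instances:
  "start_rule \<in> instances (set (all_rules h n))" "stop_rule \<in> instances (set (all_rules h n))"
  unfolding instances_def using start_stop_in_rules by force+

lemma head_rename_rule: "head (rename_rule \<theta> \<rho>) = rename_atom \<theta> ` head \<rho>"
  by (simp add: rename_rule_def head_def)

text \<open>\<open>wf_clause\<close> keeps the three control symbols out of the clauses, so each of
  them is derived by one kind of rule.\<close>

lemma rule_of_head:
  assumes "\<rho> \<in> set (all_rules h n)"
  shows "atm Started [] \<in> subst_atom \<mu> ` head \<rho> \<Longrightarrow> \<rho> = start_rule"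
    and "atm Done [] \<in> subst_atom \<mu> ` head \<rho> \<Longrightarrow> \<rho> = stop_rule"
    and "atm Bad [] \<in> subst_atom \<mu> ` head \<rho> \<Longrightarrow> \<exists>p. \<rho> = guard_rule p"
proof -
  have head_clause: "atm s [] \<noteq> subst_atom \<mu> (snd c)"
    if "c \<in> all_clauses h n" "s \<in> {Started, Bad, Done}" for c s
    using wf_all_clauses[OF that(1)] that(2) unfolding wf_clause_def by force
  show "atm Started [] \<in> subst_atom \<mu> ` head \<rho> \<Longrightarrow> \<rho> = start_rule"
    using assms
  proof (cases rule: rule_cases)
    case (horn c)
    assume "atm Started [] \<in> subst_atom \<mu> ` head \<rho>"
    with horn head_clause[OF horn(1), of Started] show ?thesis by simp
  qed auto
  show "atm Done [] \<in> subst_atom \<mu> ` head \<rho> \<Longrightarrow> \<rho> = stop_rule"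
    using assms
  proof (cases rule: rule_cases)
    case (horn c)
    assume "atm Done [] \<in> subst_atom \<mu> ` head \<rho>"
    with horn head_clause[OF horn(1), of Done] show ?thesis by simp
  qed auto
  show "atm Bad [] \<in> subst_atom \<mu> ` head \<rho> \<Longrightarrow> \<exists>p. \<rho> = guard_rule p"
    using assms
  proof (cases rule: rule_cases)
    case (horn c)
    assume "atm Bad [] \<in> subst_atom \<mu> ` head \<rho>"
    with horn head_clause[OF horn(1), of Bad] show ?thesis by simp
  qed auto
qed

text \<open>Renaming keeps predicates, so the head of an instance identifies its rule here.\<close>

lemma represents_start_stop:
  "represents (set (all_rules h n)) \<omega> start_rule \<rho> \<mu> \<Longrightarrow> \<rho> = start_rule"
  "represents (set (all_rules h n)) \<omega> stop_rule \<rho> \<mu> \<Longrightarrow> \<rho> = stop_rule"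
proof -
  have "\<rho> \<in> set (all_rules h n) \<and> (\<exists>\<nu>. head \<rho>' = subst_atom \<nu> ` head \<rho>)"
    if "represents (set (all_rules h n)) \<omega> \<rho>' \<rho> \<mu>" for \<rho>'
    using that by (auto simp: represents_def head_rename_rule rename_atom_def)
  from this[of start_rule] this[of stop_rule]
  show "represents (set (all_rules h n)) \<omega> start_rule \<rho> \<mu> \<Longrightarrow> \<rho> = start_rule"
    "represents (set (all_rules h n)) \<omega> stop_rule \<rho> \<mu> \<Longrightarrow> \<rho> = stop_rule"
    by (metis insertI1 rule_of_head(1) start_rule_simps(3),
        metis insertI1 rule_of_head(2) stop_rule_simps(3))
qed


section \<open>Trails give computations\<close>

lemma valid_all_clauses: "c \<in> all_clauses h n \<Longrightarrow> valid h n c"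
proof -
  have "v (Var n) = v (Var 0) + n" if "\<forall>a\<in>set (input_body n). true_atom h m v a" for v m
    using that by (induction n) (auto simp: holds_def)
  then have "valid h n (input_clause n)"
    by (auto simp: valid_def input_clause_def holds_def)
  then show "c \<in> all_clauses h n \<Longrightarrow> valid h n c"
    using valid_clauses[of h 1 h n] by (auto simp: base_clauses_def) (auto simp: valid_def holds_def)
qed

text \<open>\<open>v\<close> is quantified existentially because it is updated whenever a null is
  created. Facts of unguarded predicates are ignored, as the initial database may contain
  them.\<close>

definition sound_db :: "recf \<Rightarrow> nat \<Rightarrow> db \<Rightarrow> bool" where
  "sound_db h n J \<longleftrightarrow>
     (\<exists>v. v (Const 0) = 0 \<and> (\<forall>a\<in>J. pred_of a \<in> set (guarded h) \<longrightarrow> true_atom h n v a))"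

lemma not_guarded:
  "s \<in> {Started, Bad, Done} \<Longrightarrow> Pred (to_nat s) k \<notin> set (guarded h)"
  by (auto elim!: guarded_symbols)

text \<open>Horn rules preserve soundness since their clauses are valid, the successor rule since
  its fresh null can be valued freely, and the other rules since their heads are not
  guarded.\<close>

lemma sound_db_applied:
  assumes "\<rho> \<in> set (all_rules h n)" and ap: "applied J \<rho> \<mu> K" and "sound_db h n J"
  shows "sound_db h n K"
proof -
  obtain v where v: "v (Const 0) = 0"
    and J: "\<And>a. a \<in> J \<Longrightarrow> pred_of a \<in> set (guarded h) \<Longrightarrow> true_atom h n v a"
    using assms(3) by (auto simp: sound_db_def)
  have K: "K = J \<union> subst_atom \<mu> ` head \<rho>" and dom: "dom \<mu> = vars_rule \<rho>"
    and body: "subst_atom (\<mu> |` uvars \<rho>) ` pbody \<rho> \<subseteq> J"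
    using ap by (auto simp: applied_def is_match_def)
  have same: "sound_db h n K"
    if "\<And>a. a \<in> head \<rho> \<Longrightarrow> pred_of a \<in> set (guarded h) \<Longrightarrow> true_atom h n v (subst_atom \<mu> a)"
    unfolding sound_db_def K using v J that
    by (intro exI[of _ v]) (auto simp: subst_atom_def)
  from assms(1) show ?thesis
  proof (cases rule: rule_cases)
    case (horn c)
    have "\<mu> |` uvars \<rho> = \<mu>"
      using dom horn by (simp add: uvars_no_evars restrict_map_def fun_eq_iff domIff) (metis domIff)
    with body have "true_atom h n v (subst_atom \<mu> a)" if "a \<in> set (fst c)" for a
      using all_clauses_guarded[OF horn(1), of a] that horn(2)
      by (intro J) (auto simp: subst_atom_def)
    then have "true_atom h n v (subst_atom \<mu> (snd c))"
      using valid_all_clauses[OF horn(1)] v unfolding valid_def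
      by (simp add: true_atom_subst_atom)
    with horn show ?thesis by (intro same) simp
  next
    case successor
    obtain m where m: "\<mu> 1 = Some (Null m)" "m \<notin> nulls_atoms J"
      using ap successor by (auto simp: applied_def)
    have "0 \<in> dom \<mu>"
      unfolding dom successor by (simp add: vars_rule_def vars_atoms_def)
    then obtain t where t: "\<mu> 0 = Some t" by blast
    have tJ: "atm Number [t] \<in> J"
      using body t successor by simp
    have fresh: "Null m \<notin> set (args a)" if "a \<in> J" for a
      using m(2) that by (auto simp: nulls_atoms_def nulls_atom_def)
    \<comment> \<open>The null \<open>m\<close> does not occur in \<open>J\<close>, so the update
      keeps the old facts true and the value of \<open>t\<close> unchanged.\<close>
    define w where "w = v(Null m := Suc (v t))"
    have "t \<noteq> Null m" using fresh[OF tJ] by auto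
    then have "true_atom h n w (subst_atom \<mu> a)" if "a \<in> head \<rho>" for a
      using that successor m(1) t by (auto simp: holds_def w_def)
    moreover have "true_atom h n w a" if "a \<in> J" "pred_of a \<in> set (guarded h)" for a
    proof -
      have "true_atom h n w a \<longleftrightarrow> true_atom h n v a"
        using fresh[OF that(1)] by (intro true_atom_cong) (auto simp: w_def)
      with J that show ?thesis by blast
    qed
    moreover have "w (Const 0) = 0" by (simp add: w_def v)
    ultimately show ?thesis unfolding sound_db_def K by blast
  qed (auto intro!: same simp: not_guarded)
qed

text \<open>
  The start rule applies only when \<open>Started\<close> is absent, and a generating chase that applies it never
  derives \<open>Bad\<close>. By fairness of the guard rules, its initial database has no guarded predicate.
\<close>

lemma initial_db_not_guarded:
  assumes chase: "is_chase I (set (all_rules h n)) C" and I: "is_database I"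
    and gen: "generating C" and i: "i \<in> steps C" "rule_at C i = start_rule"
    and a: "a \<in> I"
  shows "pred_of a \<notin> set (guarded h)"
proof
  assume p: "pred_of a \<in> set (guarded h)"
  have I0: "db_at C 0 = I" using chase by (simp add: is_chase_def)
  have "atm Started [] \<notin> db_at C (i - 1)"
    using chase_step(2)[OF chase i(1)] i(2) by (auto simp: applied_def satisfied_no_evars)
  moreover have "I \<subseteq> db_at C (i - 1)"
    using chase_mono[OF chase, of 0 "i - 1"] i(1) I0
      order_trans[of "enat (i - 1)" "enat i" "len C"] by (simp add: steps_def)
  ultimately have S: "atm Started [] \<notin> I" by blast
  have "is_match (chase_result C) start_rule (sub_at C i |` uvars start_rule)"
    using gen i by (force simp: generating_def)
  then have B: "atm Bad [] \<notin> chase_result C"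
    by (auto simp: is_match_def)
  have fact: "is_fact a" using I a by (simp add: is_database_def)
  define \<mu> :: subst where "\<mu> = (\<lambda>x. if x < arity (pred_of a) then Some (args a ! x) else None)"
  have "subst_atom \<mu> (Atom (pred_of a) (params (arity (pred_of a)))) = a"
    using fact by (cases a) (auto simp: subst_atom_def \<mu>_def is_fact_def wf_atom_def intro: nth_equalityI)
  then have "is_match (db_at C 0) (guard_rule (pred_of a)) \<mu>"
    using S a I0 by (auto simp: is_match_def \<mu>_def split: if_splits)
  moreover have "guard_rule (pred_of a) \<in> set (all_rules h n)"
    using p by (simp add: all_rules_def base_rules_def)
  ultimately obtain j where "enat j \<le> len C" "satisfied (db_at C j) (guard_rule (pred_of a)) \<mu>"
    using chase_fair[OF chase, of _ 0 \<mu>] by (metis zero_enat_def zero_le)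
  then have "atm Bad [] \<in> chase_result C"
    by (auto simp: satisfied_no_evars chase_result_mem)
  with B show False by blast
qed

text \<open>Soundness is an invariant of the chase. It holds vacuously at first, as the initial
  database has no guarded fact, and makes \<open>Accept\<close> true when the stop rule is
  applied.\<close>

lemma trail_sound:
  assumes "is_trail (set (all_rules h n)) \<omega> [start_rule, stop_rule]"
  shows "rec_eval h [n] 0"
proof -
  let ?R = "set (all_rules h n)"
  obtain I C f where I: "is_database I" and chase: "is_chase I ?R C" and gen: "generating C"
    and f: "f ` {..<2} \<subseteq> steps C"
    and rep: "\<forall>i<2. represents ?R \<omega> ([start_rule, stop_rule] ! i) (rule_at C (f i)) (sub_at C (f i))"
    using assms unfolding is_trail_def by (auto simp: numeral_2_eq_2)
  have i: "f 0 \<in> steps C" "rule_at C (f 0) = start_rule"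
    using f rep[rule_format, of 0] represents_start_stop(1) by auto
  have j: "f 1 \<in> steps C" "rule_at C (f 1) = stop_rule"
    using f rep[rule_format, of 1] represents_start_stop(2) by auto
  have "sound_db h n (db_at C k)" if "enat k \<le> len C" for k
    using that
  proof (induction k)
    case 0
    have "db_at C 0 = I" using chase by (simp add: is_chase_def)
    then show ?case
      using initial_db_not_guarded[OF chase I gen i]
      by (auto simp: sound_db_def intro: exI[of _ "\<lambda>_. 0"])
  next
    case (Suc k)
    then have "Suc k \<in> steps C" "enat k \<le> len C"
      by (auto simp: steps_def intro: order_trans[of _ "enat (Suc k)"])
    with Suc chase_step[OF chase, of "Suc k"] show ?case
      by (auto intro: sound_db_applied)
  qed
  moreover have "enat (f 1 - 1) \<le> len C"
    using j(1) by (auto simp: steps_def intro: order_trans[of _ "enat (f 1)"])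
  moreover have "atm Accept [] \<in> db_at C (f 1 - 1)"
    using chase_step(2)[OF chase j(1)] j(2) by (auto simp: applied_def is_match_def)
  moreover have "Pred (to_nat Accept) 0 \<in> set (guarded h)"
    by (auto simp: guarded_def base_clauses_def)
  ultimately obtain v where "true_atom h n v (atm Accept [])"
    unfolding sound_db_def by fastforce
  then show ?thesis by (simp add: holds_def)
qed


section \<open>Computations give trails\<close>

text \<open>Once \<open>Started\<close> is present, the start rule is satisfied and the guards are
  blocked; these rules alone carry the chase on.\<close>

definition positive_rules :: "recf \<Rightarrow> nat \<Rightarrow> rule set" where
  "positive_rules h n = {stop_rule, successor_rule} \<union> horn_rule ` all_clauses h n"

lemma positive_rules_subset: "positive_rules h n \<subseteq> set (all_rules h n)"
  by (auto simp: positive_rules_def all_rules_def base_rules_def)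

lemma positive_rulesD:
  assumes "\<rho> \<in> positive_rules h n"
  shows "nbody \<rho> = {}" and "atm Started [] \<in> pbody \<rho>" and "wf_rule \<rho>"
proof -
  show "nbody \<rho> = {}" "atm Started [] \<in> pbody \<rho>"
    using assms by (auto simp: positive_rules_def)
  show "wf_rule \<rho>"
    using assms wf_all_rules positive_rules_subset by blast
qed

lemma rule_cases_positive:
  assumes "\<rho> \<in> set (all_rules h n)"
  shows "\<rho> = start_rule \<or> \<rho> \<in> positive_rules h n \<or> (\<exists>p. \<rho> = guard_rule p)"
  using assms unfolding positive_rules_def by (cases rule: rule_cases) blast+

text \<open>The result is closed under the clauses, so it contains \<open>Accept\<close> and then
  \<open>Done\<close>. The latter is not given initially, and only the stop rule derives it.\<close>

lemma stop_rule_fires: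
  assumes chase: "is_chase {atm Started []} (positive_rules h n) C" and h: "rec_eval h [n] 0"
  shows "\<exists>k\<in>steps C. rule_at C k = stop_rule"
proof -
  let ?J = "chase_result C"
  have started: "atm Started [] \<in> ?J"
    using chase by (auto simp: chase_result_mem is_chase_def intro!: exI[of _ 0] simp flip: zero_enat_def)
  have horn: "subst_atom (ground \<sigma>) (snd c) \<in> ?J"
    if "horn_rule c \<in> positive_rules h n" "subst_atom (ground \<sigma>) ` set (fst c) \<subseteq> ?J" for c \<sigma>
  proof -
    have "satisfied ?J (horn_rule c) (ground \<sigma> |` uvars (horn_rule c))"
      using started that positive_rulesD[OF that(1)]
      by (intro chase_result_satisfied[OF chase]) auto
    moreover have "subst_atom (ground \<sigma> |` uvars (horn_rule c)) (snd c) = subst_atom (ground \<sigma>) (snd c)"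
      by (intro subst_atom_cong) (auto simp: uvars_no_evars vars_rule_def vars_atoms_def)
    ultimately show ?thesis by (simp add: satisfied_no_evars)
  qed
  have closed: "closed_under ?J c" if "c \<in> all_clauses h n" for c
    using horn[of c] that by (auto simp: closed_under_def positive_rules_def)
  have zero: "atm Number [Const 0] \<in> ?J"
    using closed_underD[OF closed, of "([], atm Number [Const 0])" Var]
    by (simp add: base_clauses_def)
  have "\<exists>y. atm Successor [x, y] \<in> ?J \<and> atm Number [y] \<in> ?J" if "atm Number [x] \<in> ?J" for x
  proof -
    have "satisfied ?J successor_rule (ground (\<lambda>_. x) |` {0})"
      using chase_result_satisfied[OF chase, of successor_rule "\<lambda>_. x"] that started
        positive_rulesD(3)[of successor_rule h n] by (simp add: positive_rules_def)
    then obtain \<mu> where \<mu>: "dom \<mu> = {1}"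
      "subst_atom (ground (\<lambda>_. x) |` {0} ++ \<mu>) ` head successor_rule \<subseteq> ?J"
      by (auto simp: satisfied_def)
    have "1 \<in> dom \<mu>" "\<mu> 0 = None" using \<mu>(1) by auto
    with \<mu>(2) show ?thesis by (auto simp: map_add_def restrict_map_def)
  qed
  then obtain nx where nx:
    "\<And>x. atm Number [x] \<in> ?J \<Longrightarrow> atm Successor [x, nx x] \<in> ?J \<and> atm Number [nx x] \<in> ?J"
    by metis
  \<comment> \<open>Iterating the chosen successors from \<open>Const 0\<close> names every number
    by a term of the result.\<close>
  define t where "t = rec_nat (Const 0) (\<lambda>_. nx)"
  have t0: "t 0 = Const 0" by (simp add: t_def)
  have tN: "atm Number [t i] \<in> ?J" for i
    by (induction i) (auto simp: t_def zero nx)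
  have tS: "atm Successor [t i, t (Suc i)] \<in> ?J" for i
    using nx[OF tN[of i]] by (simp add: t_def)
  have "\<forall>a\<in>set (input_body n). subst_atom (ground t) a \<in> ?J"
    using tN tS by (auto dest!: input_body_atoms)
  then have "atm Input [Const 0, t n] \<in> ?J"
    using closed_underD[OF closed, of "input_clause n" t] t0 by (simp add: input_clause_def)
  moreover have "atm (Value h) [Const 0, t n] \<in> ?J"
    using clauses_complete[OF h _ t0 tN tS] closed t0 by (simp add: base_clauses_def)
  ultimately have "atm Accept [] \<in> ?J"
    using closed_underD[OF closed,
      of "([atm Input [Const 0, Var 0], atm (Value h) [Const 0, Var 0]], atm Accept [])" "\<lambda>_. t n"]
    by (simp add: base_clauses_def)
  then have "atm Done [] \<in> ?J"
    using horn[of "([atm Accept []], atm Done [])" Var]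
    by (simp add: positive_rules_def flip: stop_rule_def)
  then obtain k where k: "k \<in> steps C" "atm Done [] \<in> subst_atom (sub_at C k) ` head (rule_at C k)"
    using new_fact[OF chase] by (metis atm_simps(6) singletonD symb.distinct(3))
  then show ?thesis
    using rule_of_head(2)[of _ h n] chase_step(1)[OF chase] positive_rules_subset by blast
qed

text \<open>The application of the start rule to the empty database is put in front, so indices
  shift by one: step \<open>Suc k\<close> is step \<open>k\<close> of \<open>C\<close>.\<close>

definition start_chase :: "chase \<Rightarrow> chase" where
  "start_chase C = Chase (eSuc (len C)) (case_nat {} (db_at C))
     (\<lambda>i. if i = 1 then start_rule else rule_at C (i - 1))
     (\<lambda>i. if i = 1 then Map.empty else sub_at C (i - 1))"

lemma steps_start_chase: "i \<in> steps (start_chase C) \<longleftrightarrow> i = 1 \<or> (\<exists>k\<in>steps C. i = Suc k)"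
  by (cases i; cases "i - 1") (auto simp: steps_def start_chase_def simp flip: eSuc_enat zero_enat_def)

text \<open>Fairness: the start rule is satisfied from index 1 on; positive rules have no match over
  the empty database and inherit fairness from \<open>C\<close>; guards never match, first for lack
  of facts and then because of \<open>Started\<close>.\<close>

lemma is_chase_start_chase:
  assumes chase: "is_chase {atm Started []} (positive_rules h n) C"
  shows "is_chase {} (set (all_rules h n)) (start_chase C)"
proof -
  let ?D = "start_chase C"
  have len: "enat (Suc i) \<le> len ?D \<longleftrightarrow> enat i \<le> len C" for i
    by (simp add: start_chase_def flip: eSuc_enat)
  have db: "db_at ?D 0 = {}" "\<And>i. db_at ?D (Suc i) = db_at C i"
    by (simp_all add: start_chase_def)
  have C0: "db_at C 0 = {atm Started []}"
    using chase by (simp add: is_chase_def)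
  have started: "atm Started [] \<in> db_at C i" if "enat i \<le> len C" for i
    using chase_mono[OF chase _ that, of 0] C0 by simp
  have "rule_at ?D i \<in> set (all_rules h n) \<and>
      applied (db_at ?D (i - 1)) (rule_at ?D i) (sub_at ?D i) (db_at ?D i)"
    if i: "i \<in> steps ?D" for i
  proof (cases "i = 1")
    case True
    then show ?thesis using C0 start_stop_in_rules
      by (simp add: start_chase_def applied_def is_match_def satisfied_no_evars uvars_no_evars)
  next
    case False
    then obtain k where k: "i = Suc k" "k \<in> steps C"
      using i by (auto simp: steps_start_chase)
    then obtain l where l: "k = Suc l" by (cases k) (auto simp: steps_def)
    show ?thesis
      using chase_step[OF chase k(2)] positive_rules_subset[of h n]
      by (auto simp: start_chase_def k(1) l)
  qed
  moreover have "\<exists>j\<ge>i. enat j \<le> len ?D \<and> satisfied (db_at ?D j) \<rho> \<mu>"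
    if i: "enat i \<le> len ?D" and \<rho>: "\<rho> \<in> set (all_rules h n)" and m: "is_match (db_at ?D i) \<rho> \<mu>"
    for i \<rho> \<mu>
  proof -
    consider "\<rho> = start_rule" | "\<rho> \<in> positive_rules h n" | p where "\<rho> = guard_rule p"
      using rule_cases_positive[OF \<rho>] by blast
    then show ?thesis
    proof cases
      case 1
      have "enat 1 \<le> len ?D" using len[of 0] by (simp flip: zero_enat_def)
      moreover have "satisfied (db_at ?D j) \<rho> \<mu>" if "0 < j" "enat j \<le> len ?D" for j
        using that started[of "j - 1"] len[of "j - 1"] db(2)[of "j - 1"] 1
        by (simp add: satisfied_no_evars)
      ultimately show ?thesis
        using i by (cases "i = 0") (metis le0 zero_less_one, metis neq0_conv order_refl)
    next
      case 2
      have "\<not> is_match {} \<rho> \<mu>"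
        using positive_rulesD(2)[OF 2] by (auto simp: is_match_def)
      with m obtain k where k: "i = Suc k" by (cases i) (simp_all add: db)
      then have "enat k \<le> len C" "is_match (db_at C k) \<rho> \<mu>"
        using i m by (simp_all add: len db)
      then obtain j where "k \<le> j" "enat j \<le> len C" "satisfied (db_at C j) \<rho> \<mu>"
        by (rule chase_fair[OF chase 2])
      then show ?thesis by (intro exI[of _ "Suc j"]) (simp add: k len db)
    next
      case 3
      then have "\<not> is_match {} \<rho> \<mu>" by (simp add: is_match_def)
      with m obtain k where k: "i = Suc k" by (cases i) (simp_all add: db)
      then show ?thesis
        using m 3 started[of k] i by (auto simp: is_match_def len db)
    qed
  qed
  ultimately show ?thesis
    unfolding is_chase_def using db(1) by blast
qed

text \<open>Positive matches persist in the result. The match of the start rule does because only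
  guards derive \<open>Bad\<close>, and no step applies a guard.\<close>

lemma generating_start_chase:
  assumes chase: "is_chase {atm Started []} (positive_rules h n) C"
  shows "generating (start_chase C)"
  unfolding generating_def
proof
  let ?D = "start_chase C"
  note D = is_chase_start_chase[OF chase]
  fix i assume i: "i \<in> steps ?D"
  have ap: "applied (db_at ?D (i - 1)) (rule_at ?D i) (sub_at ?D i) (db_at ?D i)"
    by (rule chase_step(2)[OF D i])
  show "is_match (chase_result ?D) (rule_at ?D i) (sub_at ?D i |` uvars (rule_at ?D i))"
  proof (cases "i = 1")
    case True
    have "atm Bad [] \<notin> chase_result ?D"
    proof
      assume "atm Bad [] \<in> chase_result ?D"
      then obtain k where k: "k \<in> steps ?D" "atm Bad [] \<in> subst_atom (sub_at ?D k) ` head (rule_at ?D k)"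
        using new_fact[OF D] by blast
      then obtain p where "rule_at ?D k = guard_rule p"
        using rule_of_head(3) chase_step(1)[OF D] by blast
      then have nb: "nbody (rule_at ?D k) = {atm Started []}" by simp
      then have "k \<noteq> 1" by (auto simp: start_chase_def)
      then obtain l where l: "k = Suc l" "l \<in> steps C"
        using k(1) by (auto simp: steps_start_chase)
      then have "rule_at ?D k = rule_at C l" by (auto simp: start_chase_def steps_def)
      then show False
        using nb positive_rulesD(1)[OF chase_step(1)[OF chase l(2)]] by simp
    qed
    with ap True show ?thesis
      by (auto simp: start_chase_def is_match_def uvars_no_evars)
  next
    case False
    then obtain k where k: "i = Suc k" "k \<in> steps C"
      using i by (auto simp: steps_start_chase)
    then have "rule_at ?D i = rule_at C k" by (auto simp: start_chase_def steps_def)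
    then have "nbody (rule_at ?D i) = {}"
      using positive_rulesD(1) chase_step(1)[OF chase k(2)] by simp
    moreover have "enat (i - 1) \<le> len ?D"
      using i by (auto simp: steps_def intro: order_trans[of _ "enat i"])
    then have "db_at ?D (i - 1) \<subseteq> chase_result ?D"
      by (auto simp: chase_result_mem)
    ultimately show ?thesis
      using ap by (auto simp: applied_def intro: is_match_mono)
  qed
qed

lemma trail_complete:
  assumes "rec_eval h [n] 0"
  shows "is_trail (set (all_rules h n)) \<omega> [start_rule, stop_rule]"
proof -
  interpret positive_ruleset "positive_rules h n" "{atm Started []}"
    by unfold_locales (auto dest: positive_rulesD(1))
  let ?R = "set (all_rules h n)" and ?D = "start_chase seq_chase"
  note chase = is_chase_seq_chase
  obtain k where k: "k \<in> steps seq_chase" "rule_at seq_chase k = stop_rule"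
    using stop_rule_fires[OF chase assms] by blast
  have "k \<noteq> 0" using k(1) by (auto simp: steps_def)
  define f where "f i = (if i = 0 then 1 else Suc k)" for i :: nat
  have steps: "f i \<in> steps ?D" for i
    using k(1) by (auto simp: f_def steps_start_chase)
  have rule: "rule_at ?D (f 0) = start_rule" "rule_at ?D (f 1) = stop_rule"
    using k \<open>k \<noteq> 0\<close> by (simp_all add: f_def start_chase_def)
  \<comment> \<open>Both rules have no variables, so the applied substitutions are empty and fit any
    labelling.\<close>
  have sub: "sub_at ?D (f i) = Map.empty" if "i < 2" for i
  proof -
    have "vars_rule (rule_at ?D (f i)) = {}"
      using that rule by (auto simp: less_2_cases_iff)
    moreover have "dom (sub_at ?D (f i)) = vars_rule (rule_at ?D (f i))"
      using chase_step(2)[OF is_chase_start_chase[OF chase] steps[of i]] by (simp add: applied_def)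
    ultimately show ?thesis by simp
  qed
  have "represents ?R \<omega> ([start_rule, stop_rule] ! i) (rule_at ?D (f i)) (sub_at ?D (f i))"
    if "i < 2" for i
    using that rule sub[OF that] start_stop_in_rules
    by (auto simp: less_2_cases_iff represents_def intro!: exI[of _ id])
  moreover have "strict_mono_on {..<2} f"
    using \<open>k \<noteq> 0\<close> by (auto simp: strict_mono_on_def f_def)
  \<comment> \<open>The common atom is \<open>Started\<close>.\<close>
  moreover have "ground_atoms \<omega> (pbody stop_rule) \<inter> ground_atoms \<omega> (head start_rule) \<noteq> {}"
    by (simp add: ground_atoms_def)
  ultimately show ?thesis
    unfolding is_trail_def
    using start_stop_instances[of h n] is_chase_start_chase[OF chase] generating_start_chase[OF chase] steps
    by (intro conjI exI[of _ "{}"] exI[of _ ?D] exI[of _ f])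
      (auto simp: ex_disjoint_def less_2_cases_iff numeral_2_eq_2 less_Suc_eq is_database_def nulls_atoms_def)
qed


section \<open>Diagonalisation\<close>

text \<open>Since \<open>list_encode (x # xs)\<close> is
  \<open>Suc (prod_encode (x, list_encode xs))\<close>, the recursion of \<open>input_body\<close>
  carries over to codes; the trailing atom \<open>Started\<close> belongs to the base value.\<close>

lemma computable_input_rule: "computable 1 (\<lambda>xs. enc_rule (horn_rule (input_clause (xs ! 0))))"
proof -
  let ?c = "list_encode (map enc_atom [atm Number [Var 0], atm Started []])"
  let ?S = "\<lambda>n. enc_atom (atm Successor [Var n, Var (Suc n)])"
  have rec: "rec_nat ?c (\<lambda>n r. Suc (prod_encode (?S n, r))) n =
      list_encode (map enc_atom (input_body n @ [atm Started []]))" for n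
    by (induction n) simp_all
  have "computable (Suc (Suc 0)) (\<lambda>xs. Suc (prod_encode (?S (xs ! 0), xs ! 1)))"
    by (simp add: atm_def, intro computable_intros; simp)
  from computable_rec_nat[OF computable_const[of _ ?c] this]
  have "computable 1 (\<lambda>xs. list_encode (map enc_atom (input_body (hd xs) @ [atm Started []])))"
    by (simp only: rec nth_Cons_0 nth_Cons_Suc One_nat_def)
  from computable_comp1[OF this computable_nth]
  have "computable 1 (\<lambda>xs. list_encode (map enc_atom (input_body (xs ! 0) @ [atm Started []])))"
    by simp
  then show ?thesis
    unfolding horn_rule_def input_clause_def
    by (simp add: atm_def del: map_append, intro computable_intros; simp)
qed

theorem theorem4:
  fixes \<omega> :: "rule set \<Rightarrow> nat \<Rightarrow> trm"
  assumes "\<And>R. is_ruleset R \<Longrightarrow> is_labelling R (\<omega> R)"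
  shows "\<not> decidable_problem enc_input
           {(rs, \<rho>\<^sub>1, \<rho>\<^sub>2). is_ruleset (set rs) \<and>
              \<rho>\<^sub>1 \<in> instances (set rs) \<and> \<rho>\<^sub>2 \<in> instances (set rs)}
           (\<lambda>(rs, \<rho>\<^sub>1, \<rho>\<^sub>2). is_trail (set rs) (\<omega> (set rs)) [\<rho>\<^sub>1, \<rho>\<^sub>2])"
proof
  assume "decidable_problem enc_input
           {(rs, \<rho>\<^sub>1, \<rho>\<^sub>2). is_ruleset (set rs) \<and>
              \<rho>\<^sub>1 \<in> instances (set rs) \<and> \<rho>\<^sub>2 \<in> instances (set rs)}
           (\<lambda>(rs, \<rho>\<^sub>1, \<rho>\<^sub>2). is_trail (set rs) (\<omega> (set rs)) [\<rho>\<^sub>1, \<rho>\<^sub>2])"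
  then obtain d where "\<forall>x\<in>{(rs, \<rho>\<^sub>1, \<rho>\<^sub>2). is_ruleset (set rs) \<and>
         \<rho>\<^sub>1 \<in> instances (set rs) \<and> \<rho>\<^sub>2 \<in> instances (set rs)}.
      rec_eval d [enc_input x]
        (if case x of (rs, \<rho>\<^sub>1, \<rho>\<^sub>2) \<Rightarrow> is_trail (set rs) (\<omega> (set rs)) [\<rho>\<^sub>1, \<rho>\<^sub>2] then 1 else 0)"
    unfolding decidable_problem_def by blast
  then have d: "rec_eval d [enc_input (rs, \<rho>\<^sub>1, \<rho>\<^sub>2)]
      (if is_trail (set rs) (\<omega> (set rs)) [\<rho>\<^sub>1, \<rho>\<^sub>2] then 1 else 0)"
    if "is_ruleset (set rs)" "\<rho>\<^sub>1 \<in> instances (set rs)" "\<rho>\<^sub>2 \<in> instances (set rs)" for rs \<rho>\<^sub>1 \<rho>\<^sub>2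
    using that by (auto dest!: bspec[of _ _ "(rs, \<rho>\<^sub>1, \<rho>\<^sub>2)"] simp del: enc_input.simps)
  \<comment> \<open>If \<open>n\<close> is the code of a list of rules, this is the code of the
    input made of that list preceded by the input rule for \<open>n\<close>, the start rule and the
    stop rule.\<close>
  have "computable 1 (\<lambda>xs. Suc (prod_encode
      (Suc (prod_encode (enc_rule (horn_rule (input_clause (xs ! 0))), xs ! 0)),
       list_encode [enc_rule start_rule, enc_rule stop_rule])))"
    by (intro computable_intros computable_input_rule) simp
  then obtain e where e: "rec_eval e [n] (Suc (prod_encode
      (Suc (prod_encode (enc_rule (horn_rule (input_clause n)), n)),
       list_encode [enc_rule start_rule, enc_rule stop_rule])))" for n
    unfolding computable_def by (metis One_nat_def length_Cons list.size(3) nth_Cons_0)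
  \<comment> \<open>\<open>h\<close> asks \<open>d\<close> about the problem that \<open>e\<close>
    builds from the argument.\<close>
  define h where "h = CompF d [e]"
  \<comment> \<open>The base rules for \<open>h\<close> do not mention the input, so choosing their
    code as input is not circular; on it, \<open>e\<close> returns the code of
    \<open>?x\<close>.\<close>
  define n where "n = list_encode (map enc_rule (base_rules h))"
  let ?x = "(all_rules h n, start_rule, stop_rule)"
    and ?trail = "is_trail (set (all_rules h n)) (\<omega> (set (all_rules h n))) [start_rule, stop_rule]"
  have "rec_eval e [n] (enc_input ?x)"
    using e[of n] by (simp add: all_rules_def n_def)
  moreover have "rec_eval d [enc_input ?x] (if ?trail then 1 else 0)"
    by (intro d is_ruleset_all_rules start_stop_instances)
  moreover have "rec_eval h [n] z" if "rec_eval e [n] y" "rec_eval d [y] z" for y z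
    unfolding h_def using that by (intro rec_eval.comp[where ys = "[y]"]) simp_all
  ultimately have h: "rec_eval h [n] (if ?trail then 1 else 0)"
    by blast
  \<comment> \<open>A trail forces the value 0 where \<open>h\<close> has value 1; without a trail
    \<open>h\<close> has value 0, which yields a trail.\<close>
  show False
  proof (cases ?trail)
    case True
    from trail_sound[OF True] h True show False
      using rec_eval_functional by fastforce
  next
    case False
    with h have "rec_eval h [n] 0" by simp
    from trail_complete[OF this] False show False by blast
  qed
qed

end
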